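(* Let $\mathbb F$ be a finite field with $q$ elements, $A=\mathbb F[t]$, and let $\phi:A\to A\{\tau\}$ be a Drinfeld model. Then the order of vanishing at $T=1$ of the $\mathfrak p$-adic $L$-series $L_{\mathfrak p}(\phi;T)$ is independent of the place $\mathfrak p$.
   Context: $K=\mathbb F(t)$. $A\{\tau\}$ is the ring of twisted polynomials $\sum c_i\tau^i$ ($c_i\in A$) with $\tau c=c^q\tau$. A Drinfeld model (of rank $r\ge1$) is an $\mathbb F$-algebra homomorphism $\phi:A\to A\{\tau\}$, $a\mapsto\phi_a$, with $\phi_t=t+g_1\tau+\cdots+g_r\tau^r$, $g_i\in A$, $g_r\neq0$. A place is a monic irreducible $\mathfrak p\in A$; $K_{\mathfrak p}$ is the $\mathfrak p$-adic completion of $K$. Let $T$ be an indeterminate; the $T$-twisted form $\phi^\sim:A\to A[T]\{\tau\}$ is the $\mathbb F$-algebra homomorphism with $\phi^\sim_t=t+g_1T\tau+\cdots+g_rT^r\tau^r$ ($\tau$ commuting with $T$). For an $A$-algebra $S$, $S[T]$ is an $A[T]$-module via $\phi^\sim$, with $\tau$ acting by $\sum c_jT^j\mapsto\sum c_j^qT^j$. For a place $\mathfrak p$ with $\mathbb F_{\mathfrak p}=A/\mathfrak p$, $|\phi^\sim(\mathbb F_{\mathfrak p})|:=\det_{A[T]}(t-\phi^\sim_t\mid A\otimes_{\mathbb F}\mathbb F_{\mathfrak p}[T])\in A[T]$, $P_{\mathfrak p}(\phi;T):=\mathfrak p^{-1}|\phi^\sim(\mathbb F_{\mathfrak p})|\in1+TK[T]$,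 $L(\phi;T):=\prod_{\mathfrak q}P_{\mathfrak q}(\phi;T)^{-1}\in K[[T]]$ (over all places) and $L_{\mathfrak p}(\phi;T):=P_{\mathfrak p}(\phi;T)L(\phi;T)$. It is known that $L_{\mathfrak p}(\phi;T)$ converges $\mathfrak p$-adically on the closed unit disc, defining an element of the Tate algebra $K_{\mathfrak p}\langle T\rangle$, so its order of vanishing at $T=1$ makes sense. *)

theory Defs
  imports
    "HOL-Computational_Algebra.Computational_Algebra"
    "HOL-Library.Cardinality"
    "HOL-Library.Extended_Nat"
    "HOL-Algebra.Divisibility"
    "HOL-Algebra.QuotRing"
    "Jordan_Normal_Form.Determinant"
begin

hide_const (open) Divisibility.prime Divisibility.irreducible

text \<open>
  Throughout, \<open>'f\<close> is the finite field \<open>\<bbbF>\<close>, so \<open>A = \<bbbF>[t]\<close> is \<open>'f poly\<close> and \<open>K = \<bbbF>(t)\<close> is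
  \<open>'f poly fract\<close>. The type \<open>'f poly poly\<close> is used both for \<open>A[T]\<close> and for the additive group of
  \<open>A{\<tau>}\<close>, and \<open>'f poly poly poly\<close> for that of \<open>A[T]{\<tau>}\<close>.
\<close>

section \<open>Twisted polynomials and Drinfeld models\<close>

text \<open>
  The product of the twisted polynomial ring \<open>R{\<tau>}\<close> with \<open>\<tau> c = \<sigma>(c) \<tau>\<close>. Coefficients are written
  on the left of the powers of \<open>\<tau>\<close>; the additive structure is that of ordinary polynomials.
\<close>

definition twisted_mult ::
    "('r::comm_ring_1 \<Rightarrow> 'r) \<Rightarrow> 'r poly \<Rightarrow> 'r poly \<Rightarrow> 'r poly" where
  "twisted_mult \<sigma> f g =
     (\<Sum>i\<le>degree f. \<Sum>j\<le>degree g. monom (coeff f i * (\<sigma> ^^ i) (coeff g j)) (i + j))"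

text \<open>\<open>\<phi>\<close> is an \<open>\<bbbF>\<close>-algebra homomorphism \<open>A \<rightarrow> R{\<tau>}\<close>, where \<open>\<iota> : \<bbbF> \<rightarrow> R\<close> is the structure map.\<close>

definition twisted_alg_hom ::
    "('f::field \<Rightarrow> 'r::comm_ring_1) \<Rightarrow> ('r \<Rightarrow> 'r) \<Rightarrow> ('f poly \<Rightarrow> 'r poly) \<Rightarrow> bool" where
  "twisted_alg_hom \<iota> \<sigma> \<phi> \<longleftrightarrow>
     (\<forall>a b. \<phi> (a + b) = \<phi> a + \<phi> b) \<and>
     (\<forall>a b. \<phi> (a * b) = twisted_mult \<sigma> (\<phi> a) (\<phi> b)) \<and>
     (\<forall>c. \<phi> [:c:] = [:\<iota> c:])"

abbreviation var_t :: "'f::field poly" where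
  "var_t \<equiv> [:0, 1:]"

definition frob :: "'f::{field,finite} poly \<Rightarrow> 'f poly" where
  "frob a = a ^ CARD('f)"

definition drinfeld_model :: "('f::{field,finite} poly \<Rightarrow> 'f poly poly) \<Rightarrow> bool" where
  "drinfeld_model \<phi> \<longleftrightarrow>
     twisted_alg_hom (\<lambda>c. [:c:]) frob \<phi> \<and>
     coeff (\<phi> var_t) 0 = var_t \<and> degree (\<phi> var_t) \<ge> 1"

text \<open>\<open>\<tau>\<close> acts on \<open>A[T]\<close> by \<open>\<Sum>c\<^sub>j T\<^sup>j \<mapsto> \<Sum>c\<^sub>j\<^sup>q T\<^sup>j\<close>.\<close>

definition frob_T :: "'f::{field,finite} poly poly \<Rightarrow> 'f poly poly" where
  "frob_T = map_poly frob"

text \<open>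
  Replacing \<open>\<tau>\<close> by \<open>T\<tau>\<close> is multiplicative, so the formula below is the \<open>\<bbbF>\<close>-algebra homomorphism
  determined by \<open>\<phi>\<^sup>~\<^sub>t = t + g\<^sub>1 T \<tau> + \<dots> + g\<^sub>r T\<^sup>r \<tau>\<^sup>r\<close>; see \<open>twisted_form_alg_hom\<close>.
\<close>

definition twisted_form ::
    "('f::{field,finite} poly \<Rightarrow> 'f poly poly) \<Rightarrow> 'f poly \<Rightarrow> 'f poly poly poly" where
  "twisted_form \<phi> a = (\<Sum>i\<le>degree (\<phi> a). monom (monom (coeff (\<phi> a) i) i) i)"

lemma funpow_zero:
  fixes \<sigma> :: "'a::zero \<Rightarrow> 'a"
  assumes "\<sigma> 0 = 0"
  shows "(\<sigma> ^^ i) 0 = 0"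
  using assms by (induction i) auto

lemma coeff_twisted_mult:
  assumes "\<sigma> 0 = 0"
  shows "coeff (twisted_mult \<sigma> f g) n =
           (\<Sum>i\<le>n. coeff f i * (\<sigma> ^^ i) (coeff g (n - i)))"
proof -
  let ?h = "\<lambda>i. coeff f i * (\<sigma> ^^ i) (coeff g (n - i))"
  have "coeff (twisted_mult \<sigma> f g) n =
      (\<Sum>i\<le>degree f. \<Sum>j\<le>degree g.
         if i + j = n then coeff f i * (\<sigma> ^^ i) (coeff g j) else 0)"
    by (simp add: twisted_mult_def coeff_sum)
  also have "\<dots> = (\<Sum>i\<le>degree f. if i \<le> n then ?h i else 0)"
  proof (intro sum.cong refl)
    fix i
    show "(\<Sum>j\<le>degree g. if i + j = n then coeff f i * (\<sigma> ^^ i) (coeff g j) else 0) =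
          (if i \<le> n then ?h i else 0)"
    proof (cases "i \<le> n")
      case True
      have "(\<Sum>j\<le>degree g. if i + j = n then coeff f i * (\<sigma> ^^ i) (coeff g j) else 0) =
            (\<Sum>j\<le>degree g. if j = n - i then ?h i else 0)"
        using True by (intro sum.cong) auto
      also have "\<dots> = ?h i"
        using funpow_zero[of \<sigma> i, OF assms] by (auto simp: coeff_eq_0)
      finally show ?thesis using True by simp
    qed (auto intro!: sum.neutral)
  qed
  also have "\<dots> = (\<Sum>i\<in>{..degree f} \<inter> {..n}. ?h i)"
    using sum.inter_restrict[of "{..degree f}" ?h "{..n}"] by simp
  also have "\<dots> = (\<Sum>i\<le>n. ?h i)"
    by (intro sum.mono_neutral_left) (auto intro!: le_degree)
  finally show ?thesis .
qed

lemma coeff_twisted_form: "coeff (twisted_form \<phi> a) n = monom (coeff (\<phi> a) n) n"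
proof -
  have "coeff (twisted_form \<phi> a) n =
        (\<Sum>i\<le>degree (\<phi> a). if i = n then monom (coeff (\<phi> a) n) n else 0)"
    unfolding twisted_form_def coeff_sum by (intro sum.cong) auto
  thus ?thesis by (auto simp: coeff_eq_0)
qed

lemma twisted_form_alg_hom:
  assumes "drinfeld_model \<phi>"
  shows "twisted_alg_hom (\<lambda>c. [:[:c:]:]) frob_T (twisted_form \<phi>)"
proof -
  have hom: "twisted_alg_hom (\<lambda>c. [:c:]) frob \<phi>"
    using assms by (simp add: drinfeld_model_def)
  have f0: "frob 0 = 0" by (simp add: frob_def)
  have frob_T_zero: "frob_T 0 = 0" by (simp add: frob_T_def)
  have fT: "(frob_T ^^ i) (monom c n) = monom ((frob ^^ i) c) n" for i n and c :: "'a poly"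
    by (induction i) (simp_all add: frob_T_def map_poly_monom f0)
  have "twisted_form \<phi> (a * b) = twisted_mult frob_T (twisted_form \<phi> a) (twisted_form \<phi> b)" for a b
  proof (rule poly_eqI)
    fix n
    have "coeff (twisted_form \<phi> (a * b)) n =
        (\<Sum>i\<le>n. monom (coeff (\<phi> a) i * (frob ^^ i) (coeff (\<phi> b) (n - i))) n)"
      using hom by (simp add: coeff_twisted_form twisted_alg_hom_def coeff_twisted_mult f0 monom_sum)
    also have "\<dots> = coeff (twisted_mult frob_T (twisted_form \<phi> a) (twisted_form \<phi> b)) n"
      by (subst coeff_twisted_mult)
         (auto simp: coeff_twisted_form fT mult_monom frob_T_zero intro!: sum.cong)
    finally show "coeff (twisted_form \<phi> (a * b)) n =
        coeff (twisted_mult frob_T (twisted_form \<phi> a) (twisted_form \<phi> b)) n" .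
  qed
  moreover have "twisted_form \<phi> (a + b) = twisted_form \<phi> a + twisted_form \<phi> b" for a b
    using hom by (intro poly_eqI) (simp add: coeff_twisted_form twisted_alg_hom_def add_monom)
  moreover have "twisted_form \<phi> [:c:] = [:[:[:c:]:]:]" for c
    using hom
    by (intro poly_eqI) (auto simp: coeff_twisted_form twisted_alg_hom_def coeff_pCons monom_0
        split: nat.split)
  ultimately show ?thesis by (simp add: twisted_alg_hom_def)
qed

section \<open>Local factors and the L-series\<close>

definition place :: "'f::field poly \<Rightarrow> bool" where
  "place p \<longleftrightarrow> lead_coeff p = 1 \<and> Factorial_Ring.irreducible p"

definition twisted_act ::
    "'f::{field,finite} poly poly poly \<Rightarrow> 'f poly poly \<Rightarrow> 'f poly poly" where
  "twisted_act f x = (\<Sum>i\<le>degree f. coeff f i * (frob_T ^^ i) x)"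

text \<open>
  Elements of \<open>\<bbbF>\<^sub>p[T] = (A/p)[T]\<close> are represented by polynomials in \<open>T\<close> whose coefficients are reduced
  modulo \<open>p\<close>. Since \<open>A[T] \<rightarrow> \<bbbF>\<^sub>p[T]\<close> is equivariant for \<open>A[T]{\<tau>}\<close>, the action on \<open>\<bbbF>\<^sub>p[T]\<close> is computed
  on representatives.
\<close>

definition residue_act ::
    "'f::{field,finite} poly \<Rightarrow> 'f poly poly poly \<Rightarrow> 'f poly poly \<Rightarrow> 'f poly poly" where
  "residue_act p f x = map_poly (\<lambda>c. c mod p) (twisted_act f x)"

text \<open>
  The matrix of \<open>t \<otimes> 1 - 1 \<otimes> \<phi>\<^sup>~\<^sub>t\<close> on the free \<open>A[T]\<close>-module \<open>A \<otimes>\<^sub>\<bbbF> \<bbbF>\<^sub>p[T]\<close> in the basis \<open>1 \<otimes> t\<^sup>j\<close>,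
  \<open>j < deg p\<close>. The coordinate of \<open>1 \<otimes> y\<close> at \<open>1 \<otimes> t\<^sup>k\<close> is the polynomial \<open>\<Sum>\<^sub>l y\<^sub>l\<^sub>k T\<^sup>l\<close> where
  \<open>y = \<Sum>\<^sub>l (\<Sum>\<^sub>k y\<^sub>l\<^sub>k t\<^sup>k) T\<^sup>l\<close>; it has coefficients in \<open>\<bbbF> \<subseteq> A\<close>. The entry \<open>t\<close> on the diagonal is the
  constant \<open>[:var_t:]\<close> of \<open>A[T]\<close>.
\<close>

definition local_matrix ::
    "('f::{field,finite} poly \<Rightarrow> 'f poly poly) \<Rightarrow> 'f poly \<Rightarrow> 'f poly poly mat" where
  "local_matrix \<phi> p =
     mat (degree p) (degree p) (\<lambda>(k, j).
       (if k = j then [:var_t:] else 0) -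
       map_poly (\<lambda>c. [:coeff c k:]) (residue_act p (twisted_form \<phi> var_t) [:var_t ^ j:]))"

text \<open>\<open>|\<phi>\<^sup>~(\<bbbF>\<^sub>p)|\<close>\<close>

definition residue_size ::
    "('f::{field,finite} poly \<Rightarrow> 'f poly poly) \<Rightarrow> 'f poly \<Rightarrow> 'f poly poly" where
  "residue_size \<phi> p = det (local_matrix \<phi> p)"

definition local_factor ::
    "('f::{field,finite} poly \<Rightarrow> 'f poly poly) \<Rightarrow> 'f poly \<Rightarrow> 'f poly fract poly" where
  "local_factor \<phi> p =
     Polynomial.smult (inverse (to_fract p)) (map_poly to_fract (residue_size \<phi> p))"

text \<open>
  The Euler product over all places converges unconditionally for the \<open>T\<close>-adic topology, which is the
  topology of the type \<open>fps\<close>: \<open>local_factor \<phi> p\<close> is a polynomial in \<open>T\<^sup>d\<close> with \<open>d = deg p\<close>.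
\<close>

definition L_series ::
    "('f::{field,finite} poly \<Rightarrow> 'f poly poly) \<Rightarrow> 'f poly fract fps" where
  "L_series \<phi> =
     Lim (finite_subsets_at_top {p. place p})
         (\<lambda>S. \<Prod>p\<in>S. inverse (fps_of_poly (local_factor \<phi> p)))"

definition L_series_at ::
    "('f::{field,finite} poly \<Rightarrow> 'f poly poly) \<Rightarrow> 'f poly \<Rightarrow> 'f poly fract fps" where
  "L_series_at \<phi> p = fps_of_poly (local_factor \<phi> p) * L_series \<phi>"

section \<open>The completion of \<open>K\<close> at a place\<close>

text \<open>For \<open>x \<noteq> 0\<close> the exponent \<open>n\<close> is unique; the value at \<open>x = 0\<close> is irrelevant.\<close>

definition padic_val :: "'f::field poly \<Rightarrow> 'f poly fract \<Rightarrow> int" where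
  "padic_val p x =
     (THE n. \<exists>a b. x = to_fract p powi n * Fract a b \<and> \<not> p dvd a \<and> \<not> p dvd b)"

definition padic_abs :: "'f::{field,finite} poly \<Rightarrow> 'f poly fract \<Rightarrow> real" where
  "padic_abs p x =
     (if x = 0 then 0 else (real CARD('f) ^ degree p) powi (- padic_val p x))"

definition padic_cauchy_ring ::
    "'f::{field,finite} poly \<Rightarrow> (nat \<Rightarrow> 'f poly fract) ring" where
  "padic_cauchy_ring p =
     \<lparr>carrier = {x. \<forall>e>0. \<exists>N. \<forall>m\<ge>N. \<forall>n\<ge>N. padic_abs p (x m - x n) < e},
      mult = (\<lambda>x y n. x n * y n), one = (\<lambda>_. 1),
      zero = (\<lambda>_. 0), add = (\<lambda>x y n. x n + y n)\<rparr>"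

definition padic_null_seqs ::
    "'f::{field,finite} poly \<Rightarrow> (nat \<Rightarrow> 'f poly fract) set" where
  "padic_null_seqs p = {x. (\<lambda>n. padic_abs p (x n)) \<longlonglongrightarrow> 0}"

definition K_completion ::
    "'f::{field,finite} poly \<Rightarrow> (nat \<Rightarrow> 'f poly fract) set ring" where
  "K_completion p = padic_cauchy_ring p Quot padic_null_seqs p"

definition K_embed ::
    "'f::{field,finite} poly \<Rightarrow> 'f poly fract \<Rightarrow> (nat \<Rightarrow> 'f poly fract) set" where
  "K_embed p x = padic_null_seqs p +>\<^bsub>padic_cauchy_ring p\<^esub> (\<lambda>_. x)"

text \<open>The extension of the absolute value to the completion.\<close>

definition K_completion_abs ::
    "'f::{field,finite} poly \<Rightarrow> (nat \<Rightarrow> 'f poly fract) set \<Rightarrow> real" where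
  "K_completion_abs p X = (THE c. \<forall>x\<in>X. (\<lambda>n. padic_abs p (x n)) \<longlonglongrightarrow> c)"

section \<open>The Tate algebra and the order of vanishing at \<open>T = 1\<close>\<close>

text \<open>
  \<open>K\<^sub>p\<langle>T\<rangle>\<close>: power series over \<open>K\<^sub>p\<close>, given by their coefficient sequences, which converge on the
  closed unit disc.
\<close>

definition tate_algebra ::
    "'f::{field,finite} poly \<Rightarrow> (nat \<Rightarrow> (nat \<Rightarrow> 'f poly fract) set) ring" where
  "tate_algebra p =
     \<lparr>carrier = {f. (\<forall>n. f n \<in> carrier (K_completion p)) \<and>
                    (\<lambda>n. K_completion_abs p (f n)) \<longlonglongrightarrow> 0},
      mult = (\<lambda>f g n. \<Oplus>\<^bsub>K_completion p\<^esub>i\<in>{..n}. f i \<otimes>\<^bsub>K_completion p\<^esub> g (n - i)),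
      one = (\<lambda>n. if n = 0 then \<one>\<^bsub>K_completion p\<^esub> else \<zero>\<^bsub>K_completion p\<^esub>),
      zero = (\<lambda>_. \<zero>\<^bsub>K_completion p\<^esub>),
      add = (\<lambda>f g n. f n \<oplus>\<^bsub>K_completion p\<^esub> g n)\<rparr>"

definition tate_of_fps ::
    "'f::{field,finite} poly \<Rightarrow> 'f poly fract fps \<Rightarrow> nat \<Rightarrow> (nat \<Rightarrow> 'f poly fract) set" where
  "tate_of_fps p F n = K_embed p (fps_nth F n)"

text \<open>
  The order of vanishing at \<open>T = 1\<close>: the supremum of all \<open>m\<close> such that \<open>(T - 1)\<^sup>m\<close> divides \<open>f\<close> in the
  Tate algebra.
\<close>

definition vanishing_order_at_one ::
    "'f::{field,finite} poly \<Rightarrow> (nat \<Rightarrow> (nat \<Rightarrow> 'f poly fract) set) \<Rightarrow> enat" where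
  "vanishing_order_at_one p f =
     Sup {enat m | m.
       (tate_of_fps p (fps_X - 1) [^]\<^bsub>tate_algebra p\<^esub> m) divides\<^bsub>tate_algebra p\<^esub> f}"

end

theory Submission
  imports Defs "Jordan_Normal_Form.Char_Poly"
begin

text \<open>
  Write \<open>exp\<close> and \<open>log\<close> for the exponential and logarithm of \<open>\<phi>\<^sup>~\<close>, operators on \<open>K[[T]]\<close>, let
  \<open>e = exp(L(\<phi>;T))\<close>, and let \<open>A\<^sub>p\<close> be the local ring of \<open>A\<close> at \<open>p\<close>. By Cayley-Hamilton \<open>|\<phi>\<^sup>~(\<bbbF>\<^sub>p)|\<close>
  maps \<open>A[T]\<close> to \<open>pA[T]\<close>, and \<open>log\<close> maps \<open>pA\<^sub>p[[T]]\<close> to itself; hence \<open>P\<^sub>p log(1)\<close> is a unit of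
  \<open>A\<^sub>p[[T]]\<close>. As \<open>log(A\<^sub>p[[T]])\<close> is an \<open>A\<^sub>p[[T]]\<close>-module, it contains \<open>P\<^sub>p\<^sup>-\<^sup>1\<close> and \<open>L(\<phi>;T)\<close>. So \<open>e\<close> is
  integral at every place, and since its coefficients tend to \<open>0\<close> at infinity, \<open>e\<close> lies in \<open>A[T]\<close>.

  Now \<open>p L\<^sub>p = log(|\<phi>\<^sup>~(\<bbbF>\<^sub>p)| e)\<close>. The \<open>p\<close>-adic logarithm kills exactly the torsion and \<open>T\<close>
  commutes with \<open>\<tau>\<close>, so \<open>(T - 1)\<^sup>m\<close> divides \<open>L\<^sub>p\<close> if and only if it divides \<open>\<phi>\<^sup>~\<^sub>a(e)\<close> in \<open>A[T]\<close> for
  some \<open>a \<noteq> 0\<close> in \<open>A\<close>. This condition does not involve \<open>p\<close>.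
\<close>

text \<open>The \<open>p\<close>-adic logarithm is controlled by t^(q^n) - t being squarefree: the
  n-th coefficient of log has at most p^n in its denominator, whereas z^(q^n) gains q^n \<ge> 2n
  factors p once p divides z. Elements are therefore moved into pA[T] by |phi~(F_p)|, and by a
  further p where injectivity is needed.

  At infinity the balance is between L, whose n-th coefficient has valuation at least n/r by a
  weight count in the determinant, and exp, whose coefficients gain from the degrees of t^(q^n) - t.

  The obstacle in the criterion is torsion: if phi~_a(e) = (T - 1)^m P and L_p is divisible by one
  more factor T - 1, then P(1) need not be 0. It is only a torsion point, and a has to be enlarged
  to kill it; this is the reason for the quantifier over a.

  The completion enters through a convergence condition: T - 1 is a unit of K[[T]], so a quotient by
  (T - 1)^m in the Tate algebra can only be the quotient in K[[T]], and the question is whether its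
  coefficients, which lie in K, tend to 0.\<close>

no_notation vec_index (infixl "$" 100)

section \<open>The Frobenius endomorphism\<close>

lemma card_field_ge_2: "CARD('f::{field,finite}) \<ge> 2"
proof -
  have "card {0, 1 :: 'f} \<le> CARD('f)" by (rule card_mono) auto
  thus ?thesis by simp
qed

lemma power_card_field [simp]:
  fixes c :: "'f::{field,finite}"
  shows "c ^ CARD('f) = c"
proof (cases "c = 0")
  case True
  thus ?thesis using card_field_ge_2[where 'f = 'f] by simp
next
  case False
  let ?U = "UNIV - {0 :: 'f}"
  have c: "CARD('f) = Suc (card ?U)" by (simp add: card_Suc_Diff1)
  have "(\<Prod>y\<in>?U. c * y) = \<Prod>?U"
    by (rule prod.reindex_bij_witness[of _ "\<lambda>y. y / c" "\<lambda>y. c * y"]) (use False in auto)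
  hence "c ^ card ?U * \<Prod>?U = 1 * \<Prod>?U" by (simp add: prod.distrib)
  hence "c ^ card ?U = 1" by (subst (asm) mult_cancel_right) simp
  thus ?thesis by (simp only: c power_Suc mult_1_right)
qed

lemma poly_eq_0_if_all_roots:
  fixes h :: "'f::{field,finite} poly"
  assumes "degree h < CARD('f)" and "\<And>x. poly h x = 0"
  shows "h = 0"
proof (rule ccontr)
  assume "h \<noteq> 0"
  hence "card {x. poly h x = 0} \<le> degree h" by (rule card_poly_roots_bound)
  with assms show False by simp
qed

text \<open>
  The coefficients of \<open>(X + 1)\<^sup>q - X\<^sup>q - 1\<close>, a polynomial of degree less than \<open>q\<close> which vanishes on
  all of \<open>\<bbbF>\<close>.
\<close>

lemma of_nat_choose_card_field:
  assumes k: "0 < k" "k < CARD('f::{field,finite})"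
  shows "of_nat (CARD('f) choose k) = (0 :: 'f)"
proof -
  let ?q = "CARD('f)"
  let ?h = "[:1, 1:] ^ ?q - (monom 1 ?q + 1) :: 'f poly"
  have q: "?q > 0" using k by simp
  have lin: "coeff ([:1, 1 :: 'f:] ^ ?q) i = of_nat (?q choose i)" if "i \<le> ?q" for i
    using that by (simp add: coeff_linear_poly_power)
  have "degree ?h \<le> ?q"
    by (intro degree_diff_le degree_add_le order.trans[OF degree_power_le] degree_monom_le) auto
  moreover have "coeff ?h ?q = 0" using q by (simp add: lin)
  ultimately have "degree ?h < ?q \<or> ?h = 0"
    by (metis le_neq_implies_less leading_coeff_0_iff)
  moreover have "poly ?h x = 0" for x by (simp add: poly_monom)
  ultimately have "?h = 0" using poly_eq_0_if_all_roots[of ?h] by auto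
  hence "coeff ?h k = 0" by simp
  thus ?thesis using k by (simp add: lin)
qed

lemma frobenius_add_gen:
  fixes x y :: "'b::comm_ring_1"
  assumes "\<And>k. 0 < k \<Longrightarrow> k < q \<Longrightarrow> of_nat (q choose k) = (0 :: 'b)" and "q > 0"
  shows "(x + y) ^ q = x ^ q + y ^ q"
proof -
  have "(x + y) ^ q = (\<Sum>k\<in>{..q}. of_nat (q choose k) * x ^ k * y ^ (q - k))"
    by (rule binomial_ring)
  also have "\<dots> = (\<Sum>k\<in>{0, q}. of_nat (q choose k) * x ^ k * y ^ (q - k))"
    using assms(1) by (intro sum.mono_neutral_right) auto
  finally show ?thesis using assms(2) by (simp add: add.commute)
qed

lemma of_nat_poly_fract:
  "of_nat n = (to_fract [:of_nat n:] :: 'f::field poly fract)"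
proof (induction n)
  case 0
  show ?case by (simp only: of_nat_0 pCons_0_0 to_fract_0)
next
  case (Suc n)
  have "(of_nat (Suc n) :: 'f poly fract) = to_fract 1 + to_fract [:of_nat n:]"
    by (simp only: of_nat_Suc Suc to_fract_1)
  also have "\<dots> = to_fract [:of_nat (Suc n):]"
    by (simp only: to_fract_add[symmetric] of_nat_Suc one_pCons add_pCons add_0_right)
  finally show ?case .
qed

lemma frobenius_add:
  fixes x y :: "'f::{field,finite} poly fract"
  shows "(x + y) ^ (CARD('f) ^ n) = x ^ (CARD('f) ^ n) + y ^ (CARD('f) ^ n)"
proof -
  have "(x + y) ^ CARD('f) = x ^ CARD('f) + y ^ CARD('f)" for x y :: "'f poly fract"
    by (rule frobenius_add_gen)
       (auto simp: of_nat_poly_fract of_nat_choose_card_field)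
  thus ?thesis by (induction n arbitrary: x y) (simp_all add: power_mult)
qed

lemma frobenius_sum:
  fixes f :: "'a \<Rightarrow> 'f::{field,finite} poly fract"
  shows "(\<Sum>i\<in>A. f i) ^ (CARD('f) ^ n) = (\<Sum>i\<in>A. f i ^ (CARD('f) ^ n))"
  by (induction A rule: infinite_finite_induct) (simp_all add: frobenius_add zero_power)

lemma frobenius_minus:
  fixes x :: "'f::{field,finite} poly fract"
  shows "(- x) ^ (CARD('f) ^ n) = - (x ^ (CARD('f) ^ n))"
proof -
  have "(- x) ^ (CARD('f) ^ n) + x ^ (CARD('f) ^ n) = 0"
    using frobenius_add[of "- x" x n] by (simp add: zero_power)
  thus ?thesis by (simp only: eq_neg_iff_add_eq_0)
qed

lemma power_card_power_const:
  "to_fract [:c :: 'f::{field,finite}:] ^ (CARD('f) ^ n) = to_fract [:c:]"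
proof -
  have "to_fract [:c:] ^ m = to_fract [:c ^ m:]" for m
  proof (induction m)
    case 0
    show ?case by (simp only: power_0 one_pCons[symmetric] to_fract_1)
  next
    case (Suc m)
    thus ?case by (simp add: to_fract_mult[symmetric] del: to_fract_mult)
  qed
  moreover have "c ^ (CARD('f) ^ n) = c"
    by (induction n) (simp_all add: power_mult)
  ultimately show ?thesis by simp
qed

section \<open>Twisted multiplication of power series\<close>

text \<open>
  With \<open>T\<^sup>i\<close> in the role of \<open>\<tau>\<^sup>i\<close> this is the multiplication of the twisted power series ring
  \<open>K{{\<tau>}}\<close>. At the same time \<open>star a\<close> is the operator \<open>\<Sum> a\<^sub>i T\<^sup>i \<tau>\<^sup>i\<close> on \<open>K[[T]]\<close>, because
  \<open>T\<close> acts on \<open>K[[T]]\<close> as right multiplication by \<open>\<tau>\<close> acts on \<open>K{{\<tau>}}\<close>.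
\<close>

definition star ::
    "'f::{field,finite} poly fract fps \<Rightarrow> 'f poly fract fps \<Rightarrow> 'f poly fract fps" where
  "star a b = Abs_fps (\<lambda>n. \<Sum>i=0..n. a $ i * (b $ (n - i)) ^ (CARD('f) ^ i))"

lemma star_nth:
  fixes a b :: "'f::{field,finite} poly fract fps"
  shows "star a b $ n = (\<Sum>i=0..n. a $ i * (b $ (n - i)) ^ (CARD('f) ^ i))"
  by (simp add: star_def)

lemma star_add_right: "star a (b + c) = star a b + star a c"
  by (rule fps_ext) (simp add: star_nth frobenius_add algebra_simps sum.distrib)

lemma star_0_right [simp]: "star a 0 = 0"
  by (rule fps_ext) (simp add: star_nth zero_power)

lemma star_minus_right: "star a (- b) = - star a b"
  by (rule fps_ext) (simp add: star_nth frobenius_minus sum_negf)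

lemma star_diff_right: "star a (b - c) = star a b - star a c"
  using star_add_right[of a b "- c"] by (simp add: star_minus_right)

lemma star_sum_right: "star a (\<Sum>i\<in>I. f i) = (\<Sum>i\<in>I. star a (f i))"
  by (induction I rule: infinite_finite_induct) (simp_all add: star_add_right)

lemma star_const_left [simp]: "star (fps_const c) F = fps_const c * F"
proof (rule fps_ext)
  fix n
  have "star (fps_const c) F $ n = (\<Sum>i\<in>{0}. fps_const c $ i * (F $ (n - i)) ^ (CARD('a) ^ i))"
    unfolding star_nth by (rule sum.mono_neutral_right) auto
  thus "star (fps_const c) F $ n = (fps_const c * F) $ n" by simp
qed

lemma star_1_left [simp]: "star 1 F = F"
  using star_const_left[of 1 F] by simp

lemma star_const_mult_left: "star (fps_const c * a) F = fps_const c * star a F"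
  by (rule fps_ext) (simp add: star_nth sum_distrib_left mult.assoc)

text \<open>Elements of K with x^q = x are those of F, so these are the series over F. They commute
  with tau. Besides polynomials in T such as T - 1 they include 1/(1 - T), which is the reason to
  allow all power series.\<close>

definition frob_fixed :: "'f::{field,finite} poly fract fps \<Rightarrow> bool" where
  "frob_fixed h \<longleftrightarrow> (\<forall>n. (h $ n) ^ CARD('f) = h $ n)"

lemma frob_fixed_power:
  fixes h :: "'f::{field,finite} poly fract fps"
  assumes "frob_fixed h"
  shows "(h $ n) ^ (CARD('f) ^ i) = h $ n"
  using assms by (induction i) (simp_all add: frob_fixed_def power_mult)

lemma star_frob_fixed: "frob_fixed h \<Longrightarrow> star F h = F * h"
  by (rule fps_ext) (simp add: star_nth fps_mult_nth frob_fixed_power)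

text \<open>The three indices are rearranged as for ordinary series; the Frobenius powers match
  because q^i q^k = q^(i+k) and because raising to the power q^j is additive.\<close>

lemma star_assoc: "star (star a b) c = star a (star b c)"
proof (rule fps_ext)
  fix n
  let ?q = "\<lambda>i. CARD('a) ^ i"
  have "star (star a b) c $ n =
      (\<Sum>j=0..n. \<Sum>i=0..j. a $ i * (b $ (j - i)) ^ ?q i * (c $ (n - j)) ^ (?q i * ?q (j - i)))"
    unfolding star_nth sum_distrib_right by (intro sum.cong refl) (simp flip: power_add)
  also have "\<dots> = (\<Sum>j=0..n. \<Sum>i=0..n-j. a $ j * (b $ i) ^ ?q j * (c $ (n - j - i)) ^ (?q j * ?q i))"
    by (rule fps_mult_assoc_lemma[where f = "\<lambda>i k m. a $ i * (b $ k) ^ ?q i * (c $ m) ^ (?q i * ?q k)"])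
  also have "\<dots> = star a (star b c) $ n"
    unfolding star_nth frobenius_sum sum_distrib_left
    by (intro sum.cong refl) (simp add: power_mult_distrib mult.assoc mult.commute flip: power_mult)
  finally show "star (star a b) c $ n = star a (star b c) $ n" .
qed

text \<open>Multiplication by h is \<open>star\<close> by h on the right, so linearity over such h
  is associativity.\<close>

lemma star_frob_fixed_mult:
  assumes "frob_fixed h"
  shows "star a (h * F) = h * star a F"
proof -
  have "star a (h * F) = star a (star F h)" using assms by (simp add: star_frob_fixed mult.commute)
  also have "\<dots> = star (star a F) h" by (simp add: star_assoc)
  also have "\<dots> = h * star a F" using assms by (simp add: star_frob_fixed mult.commute)
  finally show ?thesis .
qed

lemma frob_fixed_X [simp]: "frob_fixed fps_X"
  by (simp add: frob_fixed_def fps_X_nth zero_power)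

lemma frob_fixed_const [simp]: "frob_fixed (fps_const (to_fract [:c:]))"
  using power_card_power_const[of c 1] by (simp add: frob_fixed_def zero_power)

lemma frob_fixed_mult:
  assumes "frob_fixed a" "frob_fixed b"
  shows "frob_fixed (a * b)"
  unfolding frob_fixed_def
proof
  fix n
  show "((a * b) $ n) ^ CARD('a) = (a * b) $ n"
    using assms frobenius_sum[of "\<lambda>i. a $ i * b $ (n - i)" "{0..n}" 1]
    by (simp add: fps_mult_nth power_mult_distrib frob_fixed_def)
qed

lemma frob_fixed_1 [simp]: "frob_fixed 1"
  by (simp add: frob_fixed_def zero_power)

lemma frob_fixed_power_fps: "frob_fixed a \<Longrightarrow> frob_fixed (a ^ n)"
  by (induction n) (simp_all add: frob_fixed_mult)

lemma frob_fixed_add: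
  fixes a b :: "'a::{field,finite} poly fract fps"
  shows "frob_fixed a \<Longrightarrow> frob_fixed b \<Longrightarrow> frob_fixed (a + b)"
  using frobenius_add[where 'f = 'a and n = 1] by (simp add: frob_fixed_def)

lemma frob_fixed_minus:
  fixes a :: "'a::{field,finite} poly fract fps"
  shows "frob_fixed a \<Longrightarrow> frob_fixed (- a)"
  using frobenius_minus[where 'f = 'a and n = 1] by (simp add: frob_fixed_def)

lemma frob_fixed_X_minus_1 [simp]: "frob_fixed (fps_X - 1)"
  using frob_fixed_add[OF frob_fixed_X frob_fixed_minus[OF frob_fixed_1]] by simp

text \<open>The lowest nonzero coefficient of a series H survives in \<open>star a H\<close>, since
  \<open>a $ 0 = 1\<close>.\<close>

lemma star_inj:
  assumes "a $ 0 = 1" and "star a F = star a G"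
  shows "F = G"
proof -
  have z: "H = 0" if "star a H = 0" for H
  proof (rule fps_ext)
    fix n
    show "H $ n = 0 $ n"
    proof (induction n rule: less_induct)
      case (less n)
      have "0 = star a H $ n" using that by simp
      also have "\<dots> = (\<Sum>i\<in>{0}. a $ i * (H $ (n - i)) ^ (CARD('a) ^ i))"
        unfolding star_nth using less by (intro sum.mono_neutral_right) (auto simp: zero_power)
      finally show ?case using assms(1) by simp
    qed
  qed
  from assms(2) have "star a (F - G) = 0" by (simp add: star_diff_right)
  from z[OF this] show ?thesis by simp
qed

section \<open>Filtrations on a field\<close>

text \<open>\<open>V m x\<close> stands for v(x) \<ge> m. The axioms ask only for the inequalities
  of a valuation, so that they cover the \<open>p\<close>-adic valuation, the one at infinity and
  its multiple by the rank.\<close>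

locale filtration =
  fixes V :: "int \<Rightarrow> 'k::field \<Rightarrow> bool"
  assumes V_0 [simp]: "V m 0"
    and V_1 [simp]: "V 0 1"
    and V_add: "V m x \<Longrightarrow> V m y \<Longrightarrow> V m (x + y)"
    and V_minus: "V m x \<Longrightarrow> V m (- x)"
    and V_mult: "V m x \<Longrightarrow> V n y \<Longrightarrow> V (m + n) (x * y)"
    and V_mono: "V m x \<Longrightarrow> n \<le> m \<Longrightarrow> V n x"
begin

lemma V_diff: "V m x \<Longrightarrow> V m y \<Longrightarrow> V m (x - y)"
  using V_add[of m x "- y"] V_minus[of m y] by simp

lemma V_sum: "(\<And>i. i \<in> I \<Longrightarrow> V m (f i)) \<Longrightarrow> V m (\<Sum>i\<in>I. f i)"
  by (induction I rule: infinite_finite_induct) (auto intro: V_add)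

lemma V_mult': "V m x \<Longrightarrow> V n y \<Longrightarrow> k \<le> m + n \<Longrightarrow> V k (x * y)"
  using V_mult V_mono by blast

lemma V_power: "V m x \<Longrightarrow> V (int n * m) (x ^ n)"
proof (induction n)
  case (Suc n)
  have "int (Suc n) * m = m + int n * m" by (simp add: algebra_simps)
  with Suc V_mult[of m x "int n * m" "x ^ n"] show ?case by simp
qed simp

lemma V_power': "V m x \<Longrightarrow> k \<le> int n * m \<Longrightarrow> V k (x ^ n)"
  using V_power V_mono by blast

lemma V_mult0: "V 0 x \<Longrightarrow> V m y \<Longrightarrow> V m (x * y)"
  using V_mult[of 0 x m y] by simp

text \<open>The weight c depends on the use: a constant measures divisibility of all coefficients by
  a power of p, while \<open>int\<close> expresses linear growth of the valuation at
  infinity.\<close>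

definition W :: "(nat \<Rightarrow> int) \<Rightarrow> 'k fps \<Rightarrow> bool" where
  "W c F \<longleftrightarrow> (\<forall>n. V (c n) (F $ n))"

lemma W_mult:
  assumes "W a F" "W b G" "\<And>i j. c (i + j) \<le> a i + b j"
  shows "W c (F * G)"
  unfolding W_def
proof
  fix n
  show "V (c n) ((F * G) $ n)"
    unfolding fps_mult_nth
  proof (rule V_sum)
    fix i assume "i \<in> {0..n}"
    with assms(3)[of i "n - i"] show "V (c n) (F $ i * G $ (n - i))"
      using assms(1,2) by (intro V_mult'[of "a i" _ "b (n - i)"]) (auto simp: W_def)
  qed
qed

lemma W_add: "W c F \<Longrightarrow> W c G \<Longrightarrow> W c (F + G)"
  by (simp add: W_def V_add)

lemma W_sum: "(\<And>i. i \<in> I \<Longrightarrow> W c (f i)) \<Longrightarrow> W c (\<Sum>i\<in>I. f i)"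
  by (simp add: W_def fps_sum_nth V_sum)

lemma W_1: "c 0 \<le> 0 \<Longrightarrow> W c 1"
  using V_mono[OF V_1, of "c 0"] by (simp add: W_def)

lemma W_prod:
  assumes "\<And>i. i \<in> I \<Longrightarrow> W c (f i)" "\<And>i j. c (i + j) \<le> c i + c j" "c 0 \<le> 0"
  shows "W c (\<Prod>i\<in>I. f i)"
  using assms(1)
proof (induction I rule: infinite_finite_induct)
  case (insert x I)
  hence "W c (f x * (\<Prod>i\<in>I. f i))" using assms(2) by (intro W_mult[where a = c and b = c]) auto
  with insert.hyps show ?case by simp
qed (simp_all add: W_1 assms(3))

text \<open>With constant term 1 the coefficients of the inverse are polynomials over the integers
  in those of F, and subadditivity of c preserves the bound.\<close>

lemma W_inverse:
  assumes "W c F" "\<And>i j. c (i + j) \<le> c i + c j" "F $ 0 = 1" "c 0 \<le> 0"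
  shows "W c (inverse F)"
  unfolding W_def
proof
  fix n
  show "V (c n) (inverse F $ n)"
  proof (induction n rule: less_induct)
    case (less n)
    show ?case
    proof (cases n)
      case 0
      with assms(3,4) show ?thesis using V_mono[OF V_1, of "c 0"] by simp
    next
      case (Suc m)
      have "0 = (F * inverse F) $ n"
        using assms(3) Suc by (simp add: inverse_mult_eq_1')
      also have "\<dots> = inverse F $ n + (\<Sum>i=1..n. F $ i * inverse F $ (n - i))"
        unfolding fps_mult_nth using assms(3) by (simp add: sum.atLeast_Suc_atMost)
      finally have "inverse F $ n = - (\<Sum>i=1..n. F $ i * inverse F $ (n - i))"
        by (simp add: eq_neg_iff_add_eq_0)
      moreover have "V (c n) (\<Sum>i=1..n. F $ i * inverse F $ (n - i))"
      proof (rule V_sum)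
        fix i assume i: "i \<in> {1..n}"
        with assms(2)[of i "n - i"] have "c n \<le> c i + c (n - i)" by simp
        moreover have "V (c i) (F $ i)" using assms(1) by (simp add: W_def)
        ultimately show "V (c n) (F $ i * inverse F $ (n - i))"
          using less[of "n - i"] i by (intro V_mult') auto
      qed
      ultimately show ?thesis by (simp add: V_minus)
    qed
  qed
qed

end

section \<open>The valuations of the rational function field\<close>

text \<open>This is v_p(x) \<ge> m rather than equality: p may divide a, and x = 0 needs no separate
  case.\<close>

definition vfil :: "'f::{field,finite} poly \<Rightarrow> int \<Rightarrow> 'f poly fract \<Rightarrow> bool" where
  "vfil p m x \<longleftrightarrow> (\<exists>a b. \<not> p dvd b \<and> x = to_fract p powi m * (to_fract a / to_fract b))"

definition vinf :: "int \<Rightarrow> 'f::{field,finite} poly fract \<Rightarrow> bool" where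
  "vinf m x \<longleftrightarrow> x = 0 \<or>
     (\<exists>a b. a \<noteq> 0 \<and> b \<noteq> 0 \<and> x = to_fract a / to_fract b \<and> int (degree a) + m \<le> int (degree b))"

lemma place_prime: "place p \<Longrightarrow> prime_elem p"
  by (simp add: place_def field_poly_irreducible_imp_prime)

lemma place_nonzero: "place p \<Longrightarrow> p \<noteq> 0"
  by (auto simp: place_def)

lemma place_not_unit: "place p \<Longrightarrow> \<not> p dvd 1"
  by (rule prime_elem_not_unit[OF place_prime])

lemma place_degree: "place p \<Longrightarrow> degree p > 0"
  using place_prime[of p] place_nonzero[of p]
  by (metis bot_nat_0.not_eq_extremum is_unit_iff_degree prime_elem_not_unit)

lemma place_dvd_mult: "place p \<Longrightarrow> p dvd a * b \<longleftrightarrow> p dvd a \<or> p dvd b"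
  using place_prime prime_elem_dvd_mult_iff by blast

lemma place_power_dvd_cancel:
  assumes "place p" "p ^ k dvd a * b" "\<not> p dvd b"
  shows "p ^ k dvd a"
  using assms(2)
proof (induction k arbitrary: a)
  case (Suc k)
  have "p dvd p ^ Suc k" by simp
  hence "p dvd a * b" using Suc.prems by (rule dvd_trans)
  hence "p dvd a" using assms by (simp add: place_dvd_mult)
  then obtain c where c: "a = p * c" by (rule dvdE)
  from Suc.prems have "p ^ k dvd c * b"
    using place_nonzero[OF assms(1)] by (simp add: c mult.assoc)
  from Suc.IH[OF this] show ?case by (simp add: c)
qed simp

lemma place_dvd_monic:
  assumes "place p" "place q" "p dvd q"
  shows "p = q"
proof -
  from assms(3) obtain c where c: "q = p * c" by (rule dvdE)
  from assms have "\<not> is_unit p" "Factorial_Ring.irreducible q" "lead_coeff p = 1" "lead_coeff q = 1"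
    by (auto simp: place_def irreducible_not_unit)
  hence "is_unit c" using c Factorial_Ring.irreducibleD by metis
  then obtain d where d: "c = [:d:]" by (rule is_unit_polyE)
  from \<open>lead_coeff q = 1\<close> \<open>lead_coeff p = 1\<close> have "d = 1"
    by (cases "d = 0") (simp_all add: c d)
  thus ?thesis by (simp add: c d)
qed

lemma place_power_decomp:
  fixes a :: "'f::{field,finite} poly"
  assumes p: "place p" and "a \<noteq> 0"
  shows "\<exists>k b. a = p ^ k * b \<and> \<not> p dvd b"
  using assms(2)
proof (induction "degree a" arbitrary: a rule: less_induct)
  case less
  show ?case
  proof (cases "p dvd a")
    case False
    thus ?thesis by (intro exI[of _ 0] exI[of _ a]) simp
  next
    case True
    then obtain b where b: "a = p * b" by (rule dvdE)
    with less.prems have "b \<noteq> 0" by auto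
    moreover have "degree b < degree a"
      using \<open>b \<noteq> 0\<close> place_nonzero[OF p] place_degree[OF p] by (simp add: b degree_mult_eq)
    ultimately obtain k c where "b = p ^ k * c" "\<not> p dvd c" using less.hyps by blast
    thus ?thesis by (intro exI[of _ "Suc k"] exI[of _ c]) (simp add: b)
  qed
qed

lemma filtration_vfil:
  assumes p: "place p"
  shows "filtration (vfil p)"
proof
  note p0 = place_nonzero[OF p]
  have p1: "\<not> p dvd 1" by (rule place_not_unit[OF p])
  fix m n x y
  show "vfil p m 0" unfolding vfil_def by (rule exI[of _ 0], rule exI[of _ 1], rule conjI[OF p1]) simp
  show "vfil p 0 1" unfolding vfil_def by (rule exI[of _ 1], rule exI[of _ 1], rule conjI[OF p1]) simp
  {
    assume "vfil p m x" "vfil p m y"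
    then obtain a b c d where *: "\<not> p dvd b" "\<not> p dvd d"
      "x = to_fract p powi m * (to_fract a / to_fract b)"
      "y = to_fract p powi m * (to_fract c / to_fract d)" unfolding vfil_def by auto
    hence "b \<noteq> 0" "d \<noteq> 0" by auto
    hence "x + y = to_fract p powi m * (to_fract (a * d + c * b) / to_fract (b * d))"
      by (simp add: * field_simps)
    thus "vfil p m (x + y)" using * p unfolding vfil_def by (metis place_dvd_mult)
  }
  {
    assume "vfil p m x"
    then obtain a b where "\<not> p dvd b" "x = to_fract p powi m * (to_fract a / to_fract b)"
      unfolding vfil_def by auto
    hence "\<not> p dvd b \<and> - x = to_fract p powi m * (to_fract (- a) / to_fract b)" by simp
    thus "vfil p m (- x)" unfolding vfil_def by blast
  }
  {
    assume "vfil p m x" "vfil p n y"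
    then obtain a b c d where *: "\<not> p dvd b" "\<not> p dvd d"
      "x = to_fract p powi m * (to_fract a / to_fract b)"
      "y = to_fract p powi n * (to_fract c / to_fract d)" unfolding vfil_def by auto
    hence "x * y = to_fract p powi (m + n) * (to_fract (a * c) / to_fract (b * d))"
      using p0 by (simp add: power_int_add)
    thus "vfil p (m + n) (x * y)" using * p unfolding vfil_def by (metis place_dvd_mult)
  }
  {
    assume "vfil p m x" "n \<le> m"
    then obtain a b where *: "\<not> p dvd b" "x = to_fract p powi m * (to_fract a / to_fract b)"
      unfolding vfil_def by auto
    have pow: "to_fract (p ^ k) = to_fract p ^ k" for k by (induction k) simp_all
    have "to_fract p powi m = to_fract p powi (n + int (nat (m - n)))" using \<open>n \<le> m\<close> by simp
    also have "\<dots> = to_fract p powi n * to_fract (p ^ nat (m - n))"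
      using p0 by (subst power_int_add) (simp_all only: pow power_int_of_nat to_fract_eq_0_iff simp_thms)
    finally have "x = to_fract p powi n * (to_fract (p ^ nat (m - n) * a) / to_fract b)"
      by (simp add: *)
    thus "vfil p n x" using *(1) unfolding vfil_def by blast
  }
qed

lemma to_fract_power [simp]: "to_fract (a ^ n) = to_fract a ^ n"
  by (induction n) simp_all

lemma vfil_to_fract:
  assumes "place p"
  shows "vfil p (int k) (to_fract a) \<longleftrightarrow> p ^ k dvd a"
proof
  assume "vfil p (int k) (to_fract a)"
  then obtain c d where *: "\<not> p dvd d" "to_fract a = to_fract (p ^ k * c) / to_fract d"
    unfolding vfil_def by auto
  hence "d \<noteq> 0" by auto
  with * have "to_fract (a * d) = to_fract (p ^ k * c)" by (simp add: field_simps)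
  hence "p ^ k dvd a * d" by (simp only: to_fract_eq_iff) simp
  thus "p ^ k dvd a" using place_power_dvd_cancel assms *(1) by blast
next
  assume "p ^ k dvd a"
  then obtain c where c: "a = p ^ k * c" by (rule dvdE)
  have "\<not> p dvd 1" by (rule place_not_unit[OF assms])
  moreover have "to_fract a = to_fract p powi int k * (to_fract c / to_fract 1)" by (simp add: c)
  ultimately show "vfil p (int k) (to_fract a)" unfolding vfil_def by blast
qed

lemma vfil_0_to_fract: "place p \<Longrightarrow> vfil p 0 (to_fract a)"
  using vfil_to_fract[of p 0] by simp

lemma vfil_1_to_fract: "place p \<Longrightarrow> vfil p 1 (to_fract a) \<longleftrightarrow> p dvd a"
  using vfil_to_fract[of p 1] by simp

lemma vfil_inverse: "\<not> p dvd b \<Longrightarrow> vfil p 0 (inverse (to_fract b))"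
  unfolding vfil_def by (rule exI[of _ 1], rule exI[of _ b]) (simp add: divide_inverse)

lemma vfil_inverse_place:
  assumes "place p"
  shows "vfil p (- 1) (inverse (to_fract p))"
proof -
  have "\<not> p dvd 1" by (rule place_not_unit[OF assms])
  thus ?thesis unfolding vfil_def by (intro exI[of _ 1]) (simp add: power_int_minus)
qed

text \<open>Meant for b = t^(q^n) - t, where it limits the loss in each step of the recursion for
  the logarithm to one factor p.\<close>

lemma vfil_inverse_squarefree:
  assumes "place p" "\<not> p ^ 2 dvd b"
  shows "vfil p (- 1) (inverse (to_fract b))"
proof -
  interpret filtration "vfil p" using assms(1) by (rule filtration_vfil)
  show ?thesis
  proof (cases "p dvd b")
    case True
    then obtain c where c: "b = p * c" by (rule dvdE)
    with assms have "\<not> p dvd c" by (auto simp: power2_eq_square)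
    from V_mult[OF vfil_inverse_place[OF assms(1)] vfil_inverse[OF this]] show ?thesis
      by (simp add: c)
  next
    case False
    from V_mono[OF vfil_inverse[OF this], of "- 1"] show ?thesis by simp
  qed
qed

lemma vfil_all_imp_0:
  assumes p: "place p" and x: "\<And>k. vfil p (int k) x"
  shows "x = 0"
proof -
  interpret filtration "vfil p" using p by (rule filtration_vfil)
  obtain a b where ab: "x = to_fract a / to_fract b" "b \<noteq> 0"
    by (cases x) (auto simp: Fract_conv_to_fract)
  have "p ^ k dvd a" for k
  proof -
    have "to_fract a = x * to_fract b" using ab by simp
    with V_mult[OF x[of k] vfil_0_to_fract[OF p, of b]] have "vfil p (int k) (to_fract a)" by simp
    thus ?thesis using vfil_to_fract[OF p] by blast
  qed
  hence d: "p ^ Suc (degree a) dvd a" by blast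
  have "degree (p ^ Suc (degree a)) > degree a"
    using place_degree[OF p] place_nonzero[OF p] mult_le_mono2[of 1 "degree p" "Suc (degree a)"]
    by (subst degree_power_eq) (auto simp: algebra_simps)
  with d have "a = 0" using dvd_imp_degree_le by (metis not_le)
  thus ?thesis by (simp add: ab)
qed

section \<open>The valuation at infinity\<close>

lemma filtration_vinf: "filtration (vinf :: int \<Rightarrow> 'f::{field,finite} poly fract \<Rightarrow> bool)"
proof
  fix m n and x y :: "'f poly fract"
  show "vinf m (0 :: 'f poly fract)" by (simp add: vinf_def)
  show "vinf 0 (1 :: 'f poly fract)"
    unfolding vinf_def by (intro disjI2 exI[of _ 1]) simp
  {
    assume xy: "vinf m x" "vinf m (y :: 'f poly fract)"
    show "vinf m (x + y)"
    proof (cases "x = 0 \<or> y = 0 \<or> x + y = 0")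
      case True
      thus ?thesis using xy by (auto simp: vinf_def)
    next
      case False
      with xy obtain a b c d where *: "a \<noteq> 0" "b \<noteq> 0" "c \<noteq> 0" "d \<noteq> 0"
        "x = to_fract a / to_fract b" "y = to_fract c / to_fract d"
        "int (degree a) + m \<le> int (degree b)" "int (degree c) + m \<le> int (degree d)"
        unfolding vinf_def by blast
      have e: "x + y = to_fract (a * d + c * b) / to_fract (b * d)"
        using * by (simp add: field_simps)
      with False have "to_fract (a * d + c * b) \<noteq> 0" by (metis div_0)
      hence "a * d + c * b \<noteq> 0" by (simp only: to_fract_eq_0_iff not_False_eq_True)
      moreover have "int (degree (a * d + c * b)) + m \<le> int (degree (b * d))"
      proof -
        have "degree (a * d + c * b) \<le> max (degree (a * d)) (degree (c * b))"
          by (rule degree_add_le_max)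
        thus ?thesis using * by (auto simp: degree_mult_eq)
      qed
      ultimately show ?thesis using e * unfolding vinf_def by (metis mult_eq_0_iff)
    qed
  }
  {
    assume x: "vinf m (x :: 'f poly fract)"
    show "vinf m (- x)"
    proof (cases "x = 0")
      case False
      with x obtain a b where "a \<noteq> 0" "b \<noteq> 0" "x = to_fract a / to_fract b"
        "int (degree a) + m \<le> int (degree b)" by (auto simp: vinf_def)
      thus ?thesis unfolding vinf_def by (intro disjI2 exI[of _ "- a"] exI[of _ b]) simp
    qed (simp add: vinf_def)
  }
  {
    assume xy: "vinf m x" "vinf n (y :: 'f poly fract)"
    show "vinf (m + n) (x * y)"
    proof (cases "x = 0 \<or> y = 0")
      case True
      thus ?thesis by (auto simp: vinf_def)
    next
      case False
      with xy obtain a b c d where *: "a \<noteq> 0" "b \<noteq> 0" "c \<noteq> 0" "d \<noteq> 0"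
        "x = to_fract a / to_fract b" "y = to_fract c / to_fract d"
        "int (degree a) + m \<le> int (degree b)" "int (degree c) + n \<le> int (degree d)"
        unfolding vinf_def by blast
      thus ?thesis unfolding vinf_def
        by (intro disjI2 exI[of _ "a * c"] exI[of _ "b * d"]) (simp add: degree_mult_eq)
    qed
  }
  {
    assume "vinf m (x :: 'f poly fract)" "n \<le> m"
    thus "vinf n x" unfolding vinf_def by force
  }
qed

interpretation vinf: filtration vinf by (rule filtration_vinf)

lemma vinf_to_fract: "vinf (- int (degree a)) (to_fract a)"
proof (cases "a = 0")
  case False
  thus ?thesis unfolding vinf_def by (intro disjI2 exI[of _ a] exI[of _ 1]) simp
qed (simp add: vinf_def)

lemma vinf_inverse: "b \<noteq> 0 \<Longrightarrow> vinf (int (degree b)) (inverse (to_fract b))"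
  unfolding vinf_def by (intro disjI2 exI[of _ 1] exI[of _ b]) (simp add: divide_inverse)

text \<open>A nonzero polynomial has valuation - deg a \<le> 0 at infinity. This discreteness turns
  decay of the coefficients of exp(L) into vanishing.\<close>

lemma vinf_1_to_fract:
  assumes "vinf 1 (to_fract a)"
  shows "a = 0"
proof (rule ccontr)
  assume "a \<noteq> 0"
  with assms obtain c d where *: "c \<noteq> 0" "d \<noteq> 0" "to_fract a = to_fract c / to_fract d"
    "int (degree c) + 1 \<le> int (degree d)" by (auto simp: vinf_def)
  hence "to_fract (a * d) = to_fract c" by (simp add: field_simps)
  hence "a * d = c" by (simp only: to_fract_eq_iff)
  with * \<open>a \<noteq> 0\<close> show False by (auto simp: degree_mult_eq)
qed

section \<open>Integrality at all finite places\<close>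

lemma exists_place_dvd:
  fixes b :: "'f::{field,finite} poly"
  assumes "degree b > 0"
  shows "\<exists>p. place p \<and> p dvd b"
  using assms
proof (induction "degree b" arbitrary: b rule: less_induct)
  case less
  show ?case
  proof (cases "Factorial_Ring.irreducible b")
    case True
    let ?p = "Polynomial.smult (inverse (lead_coeff b)) b"
    have b0: "lead_coeff b \<noteq> 0" using less.prems by auto
    have d1: "?p dvd b" using b0 by (simp add: smult_dvd_iff)
    have "lead_coeff ?p = 1" using b0 by simp
    moreover have "Factorial_Ring.irreducible ?p"
      using True b0 irreducible_mult_unit_left[of "[:inverse (lead_coeff b):]" b]
      by (simp add: is_unit_const_poly_iff dvd_field_iff)
    ultimately have "place ?p" by (simp add: place_def)
    thus ?thesis using d1 by blast
  next
    case False
    have "b \<noteq> 0" using less.prems by auto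
    moreover from this have "\<not> is_unit b" using less.prems by (simp add: is_unit_iff_degree)
    ultimately have "b \<noteq> 0" "\<not> is_unit b" by simp_all
    with False obtain c d where cd: "b = c * d" "\<not> is_unit c" "\<not> is_unit d"
      unfolding Factorial_Ring.irreducible_def by blast
    with \<open>b \<noteq> 0\<close> have "c \<noteq> 0" "d \<noteq> 0" by auto
    with cd have "degree c > 0" "degree d > 0" by (auto simp: is_unit_iff_degree)
    with cd \<open>c \<noteq> 0\<close> \<open>d \<noteq> 0\<close> less.hyps[of c] show ?thesis
      by (auto simp: degree_mult_eq)
  qed
qed

text \<open>In a representation with denominator of least degree, a place dividing the denominator
  would divide the numerator as well and could be cancelled.\<close>

lemma everywhere_integral:
  assumes "\<And>p. place p \<Longrightarrow> vfil p 0 x"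
  shows "x \<in> range to_fract"
proof -
  define P where "P d \<longleftrightarrow> (\<exists>a b. b \<noteq> 0 \<and> x = to_fract a / to_fract b \<and> degree b = d)" for d
  have "\<exists>d. P d" unfolding P_def by (cases x) (auto simp: Fract_conv_to_fract)
  hence "P (LEAST d. P d)" by (rule LeastI_ex)
  then obtain a b where ab: "b \<noteq> 0" "x = to_fract a / to_fract b" "degree b = (LEAST d. P d)"
    unfolding P_def by blast
  show ?thesis
  proof (cases "degree b = 0")
    case True
    then obtain c where c: "b = [:c:]" by (auto elim: degree_eq_zeroE)
    with ab have "to_fract b * to_fract [:inverse c:] = 1"
      by (auto simp: one_pCons[symmetric] simp flip: to_fract_mult)
    hence "to_fract [:inverse c:] = inverse (to_fract b)" by (rule inverse_unique[symmetric])
    hence "x = to_fract (a * [:inverse c:])" using ab by (simp only: to_fract_mult divide_inverse)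
    thus ?thesis by blast
  next
    case False
    then obtain p where p1: "place p" "p dvd b" using exists_place_dvd[of b] by auto
    from p1(2) obtain b' where "b = p * b'" by (rule dvdE)
    with p1 have p: "place p" "b = p * b'" by simp_all
    then obtain c d where cd: "\<not> p dvd d" "x = to_fract c / to_fract d"
      using assms[of p] unfolding vfil_def by auto
    hence "d \<noteq> 0" by auto
    with cd ab have "to_fract (a * d) = to_fract (c * b)" by (simp add: field_simps)
    hence "a * d = c * b" by (simp only: to_fract_eq_iff)
    hence "p dvd a * d" using p by simp
    hence "p dvd a" using cd p by (simp add: place_dvd_mult)
    then obtain a' where a': "a = p * a'" by (rule dvdE)
    have "b' \<noteq> 0" using p ab by auto
    moreover have "x = to_fract a' / to_fract b'" using place_nonzero[OF p(1)] ab p a' by simp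
    ultimately have "P (degree b')" unfolding P_def by blast
    hence "degree b \<le> degree b'" unfolding ab(3) by (rule Least_le)
    moreover have "degree b = degree p + degree b'"
      using p \<open>b' \<noteq> 0\<close> place_nonzero[OF p(1)] by (simp add: degree_mult_eq)
    ultimately show ?thesis using place_degree[OF p(1)] by simp
  qed
qed

section \<open>Logarithm and exponential of the twisted form\<close>

definition emb :: "'f::{field,finite} poly poly \<Rightarrow> 'f poly fract fps" where
  "emb P = fps_of_poly (map_poly to_fract P)"

lemma emb_nth [simp]: "emb P $ n = to_fract (coeff P n)"
  by (simp add: emb_def coeff_map_poly)

lemma emb_0 [simp]: "emb 0 = 0"
  and emb_1 [simp]: "emb 1 = 1"
  and emb_add: "emb (P + Q) = emb P + emb Q"
  and emb_diff: "emb (P - Q) = emb P - emb Q"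
  and emb_const: "emb [:a:] = fps_const (to_fract a)"
  and emb_pCons: "emb (pCons a P) = fps_const (to_fract a) + fps_X * emb P"
  by (rule fps_ext; simp add: coeff_pCons split: nat.split)+

lemma emb_mult: "emb (P * Q) = emb P * emb Q"
  by (simp add: emb_def fract_poly_mult fps_of_poly_mult)

lemma emb_sum: "emb (\<Sum>i\<in>I. f i) = (\<Sum>i\<in>I. emb (f i))"
  by (induction I rule: infinite_finite_induct) (simp_all add: emb_add)

lemma emb_eq_iff [simp]: "emb P = emb Q \<longleftrightarrow> P = Q"
  by (metis emb_nth poly_eqI to_fract_eq_iff)

lemma emb_eqI:
  assumes "\<And>n. F $ n \<in> range to_fract" "\<And>n. n \<ge> N \<Longrightarrow> F $ n = 0"
  shows "\<exists>P. F = emb P"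
proof -
  define h where "h n = (SOME a. F $ n = to_fract a)" for n
  have h: "F $ n = to_fract (h n)" for n
    unfolding h_def by (rule someI_ex[of "\<lambda>a. F $ n = to_fract a"]) (use assms(1)[of n] in auto)
  have "F $ n = emb (\<Sum>i<N. monom (h i) i) $ n" for n
  proof (cases "n < N")
    case True
    thus ?thesis by (simp add: coeff_sum h)
  next
    case False
    thus ?thesis using assms(2)[of n] by (simp add: coeff_sum)
  qed
  hence "F = emb (\<Sum>i<N. monom (h i) i)" by (rule fps_ext)
  thus ?thesis by blast
qed

lemma emb_eq_0_iff [simp]: "emb P = 0 \<longleftrightarrow> P = 0"
  using emb_eq_iff[of P 0] by simp

abbreviation fract_t :: "'f::{field,finite} poly fract" where
  "fract_t \<equiv> to_fract var_t"

text \<open>The Carlitz bracket [n], which measures how far tau^n is from commuting with t: tau^n t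
  - t tau^n = [n] tau^n. It is 0 for n = 0, hence the assumption n > 0 below.\<close>

definition frob_diff :: "nat \<Rightarrow> 'f::{field,finite} poly" where
  "frob_diff n = var_t ^ (CARD('f) ^ n) - var_t"

lemma card_power_gt_1: "n > 0 \<Longrightarrow> CARD('f::{field,finite}) ^ n > 1"
  using card_field_ge_2[where 'f = 'f] by (intro one_less_power) auto

text \<open>The factor 2 leaves room for denominators: with i factors p lost in the i-th coefficient
  of log and q^i gained from the argument, at least i remain.\<close>

lemma card_power_ge: "CARD('f::{field,finite}) ^ n \<ge> 2 * n"
proof (induction n)
  case (Suc n)
  have "2 * Suc n \<le> 2 * CARD('f) ^ n"
    using Suc card_power_gt_1[of n, where 'f = 'f] by (cases n) auto
  also have "\<dots> \<le> CARD('f) ^ Suc n" using card_field_ge_2[where 'f = 'f] by simp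
  finally show ?case .
qed simp

lemma var_t_power: "(var_t :: 'f::field poly) ^ n = monom 1 n"
  by (metis monom_altdef mult_1 smult_1_left)

lemma degree_frob_diff:
  assumes "n > 0"
  shows "degree (frob_diff n :: 'f::{field,finite} poly) = CARD('f) ^ n"
proof -
  have "degree (- var_t :: 'f poly) < degree (var_t ^ (CARD('f) ^ n) :: 'f poly)"
    using card_power_gt_1[OF assms, where 'f = 'f] by (simp add: var_t_power degree_monom_eq)
  from degree_add_eq_left[OF this] show ?thesis
    unfolding frob_diff_def diff_conv_add_uminus by (simp add: var_t_power degree_monom_eq)
qed

lemma frob_diff_nonzero: "n > 0 \<Longrightarrow> frob_diff n \<noteq> (0 :: 'f::{field,finite} poly)"
  using degree_frob_diff[of n, where 'f = 'f] card_power_gt_1[of n, where 'f = 'f] by auto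

text \<open>The derivative of \<open>t\<^bsup>q^n\<^esup> - t\<close> is \<open>-1\<close>.\<close>

lemma frob_diff_squarefree:
  fixes p :: "'f::{field,finite} poly"
  assumes "place p" "n > 0"
  shows "\<not> p ^ 2 dvd frob_diff n"
proof
  assume "p ^ 2 dvd frob_diff n"
  then obtain c where c: "frob_diff n = p ^ 2 * c" by (rule dvdE)
  have z: "(of_nat (CARD('f)) :: 'f) = 0"
    using of_nat_choose_card_field[of 1, where 'f = 'f] card_field_ge_2[where 'f = 'f] by simp
  have "(of_nat (CARD('f) ^ n) :: 'f) = 0" using assms(2) z by (simp add: zero_power)
  hence "pderiv (frob_diff n :: 'f poly) = - 1"
    using assms(2)
    by (simp add: frob_diff_def var_t_power pderiv_diff pderiv_monom pderiv_pCons one_pCons del: of_nat_power)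
  moreover have "p dvd pderiv (p ^ 2 * c)"
    by (simp add: pderiv_mult power2_eq_square)
  ultimately have "p dvd 1" using c by simp
  thus False using place_not_unit[OF assms(1)] by blast
qed

locale drinfeld =
  fixes \<phi> :: "'f::{field,finite} poly \<Rightarrow> 'f poly poly"
  assumes drinfeld: "drinfeld_model \<phi>"
begin

definition phi_t :: "'f poly poly" where "phi_t = \<phi> var_t"

lemma coeff_phi_t_0: "coeff phi_t 0 = var_t"
  using drinfeld by (simp add: phi_t_def drinfeld_model_def)

definition rk :: nat where "rk = degree phi_t"

lemma rk_pos: "rk > 0"
  using drinfeld by (simp add: rk_def phi_t_def drinfeld_model_def)

text \<open>Comparison of the coefficients of tau^n in log phi_t = t log; the two terms with the
  n-th coefficient combine to [n] times it. \<open>exp_coeff\<close> solves exp t = phi_t exp in the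
  same way.\<close>

function log_coeff :: "nat \<Rightarrow> 'f poly fract" where
  "log_coeff n = (if n = 0 then 1 else
     - (\<Sum>i<n. log_coeff i * (emb phi_t $ (n - i)) ^ (CARD('f) ^ i)) * inverse (to_fract (frob_diff n)))"
  by auto
termination by (relation "measure id") auto

function exp_coeff :: "nat \<Rightarrow> 'f poly fract" where
  "exp_coeff n = (if n = 0 then 1 else
     (\<Sum>i<n. emb phi_t $ (n - i) * exp_coeff i ^ (CARD('f) ^ (n - i))) * inverse (to_fract (frob_diff n)))"
  by auto
termination by (relation "measure id") auto

declare log_coeff.simps [simp del] exp_coeff.simps [simp del]

lemma log_coeff_0 [simp]: "log_coeff 0 = 1" by (simp add: log_coeff.simps)
lemma exp_coeff_0 [simp]: "exp_coeff 0 = 1" by (simp add: exp_coeff.simps)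

definition log_series :: "'f poly fract fps" where "log_series = Abs_fps log_coeff"
definition exp_series :: "'f poly fract fps" where "exp_series = Abs_fps exp_coeff"

lemma log_series_nth [simp]: "log_series $ n = log_coeff n" by (simp add: log_series_def)
lemma exp_series_nth [simp]: "exp_series $ n = exp_coeff n" by (simp add: exp_series_def)

lemma star_const_right_nth: "star a (fps_const c) $ n = a $ n * c ^ (CARD('f) ^ n)"
  for a :: "'f poly fract fps"
proof -
  have "star a (fps_const c) $ n = (\<Sum>i\<in>{n}. a $ i * (fps_const c $ (n - i)) ^ (CARD('f) ^ i))"
    unfolding star_nth by (intro sum.mono_neutral_right) (auto simp: zero_power)
  thus ?thesis by simp
qed

lemma to_fract_frob_diff:
  "to_fract (frob_diff n :: 'f poly) = fract_t ^ (CARD('f) ^ n) - fract_t"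
  by (simp add: frob_diff_def)

lemma log_series_star: "star log_series (emb phi_t) = fps_const fract_t * log_series"
proof (rule fps_ext)
  fix n
  show "star log_series (emb phi_t) $ n = (fps_const fract_t * log_series) $ n"
  proof (cases "n = 0")
    case True
    thus ?thesis by (simp add: star_nth coeff_phi_t_0)
  next
    case False
    have "to_fract (frob_diff n) \<noteq> (0 :: 'f poly fract)"
      using frob_diff_nonzero[of n, where 'f = 'f] False by simp
    hence "(\<Sum>i<n. log_coeff i * (emb phi_t $ (n - i)) ^ (CARD('f) ^ i)) =
        - log_coeff n * to_fract (frob_diff n)"
      using False by (subst log_coeff.simps) (simp add: field_simps)
    moreover have "star log_series (emb phi_t) $ n =
        (\<Sum>i<n. log_coeff i * (emb phi_t $ (n - i)) ^ (CARD('f) ^ i)) + log_coeff n * fract_t ^ (CARD('f) ^ n)"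
      unfolding star_nth atLeast0AtMost
      by (simp add: lessThan_Suc_atMost[symmetric] coeff_phi_t_0)
    ultimately show ?thesis by (simp add: to_fract_frob_diff algebra_simps)
  qed
qed

lemma exp_series_star: "star exp_series (fps_const fract_t) = star (emb phi_t) exp_series"
proof (rule fps_ext)
  fix n
  show "star exp_series (fps_const fract_t) $ n = star (emb phi_t) exp_series $ n"
  proof (cases "n = 0")
    case True
    thus ?thesis by (simp add: star_nth coeff_phi_t_0)
  next
    case False
    have "to_fract (frob_diff n) \<noteq> (0 :: 'f poly fract)"
      using frob_diff_nonzero[of n, where 'f = 'f] False by simp
    hence "(\<Sum>i<n. emb phi_t $ (n - i) * exp_coeff i ^ (CARD('f) ^ (n - i))) =
        exp_coeff n * to_fract (frob_diff n)"
      using False by (subst exp_coeff.simps) (simp add: field_simps)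
    moreover have "star (emb phi_t) exp_series $ n =
        fract_t * exp_coeff n + (\<Sum>i=1..n. emb phi_t $ i * exp_coeff (n - i) ^ (CARD('f) ^ i))"
      unfolding star_nth by (simp add: sum.atLeast_Suc_atMost coeff_phi_t_0)
    moreover have "(\<Sum>i=1..n. emb phi_t $ i * exp_coeff (n - i) ^ (CARD('f) ^ i)) =
        (\<Sum>i<n. emb phi_t $ (n - i) * exp_coeff i ^ (CARD('f) ^ (n - i)))"
      by (rule sum.reindex_bij_witness[of _ "\<lambda>i. n - i" "\<lambda>i. n - i"]) auto
    ultimately show ?thesis
      by (simp add: star_const_right_nth to_fract_frob_diff algebra_simps)
  qed
qed

text \<open>The composite commutes with t, so its coefficient at tau^n is annihilated by t^(q^n) -
  t.\<close>

lemma log_exp_series: "star log_series exp_series = 1"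
proof -
  let ?c = "star log_series exp_series"
  have "star ?c (fps_const fract_t) = star (star log_series (emb phi_t)) exp_series"
    by (simp add: star_assoc exp_series_star)
  also have "\<dots> = fps_const fract_t * ?c" by (simp add: log_series_star star_const_mult_left)
  finally have *: "?c $ n * fract_t ^ (CARD('f) ^ n) = fract_t * ?c $ n" for n
    by (metis star_const_right_nth fps_mult_left_const_nth)
  show ?thesis
  proof (rule fps_ext)
    fix n
    show "?c $ n = 1 $ n"
    proof (cases "n = 0")
      case False
      have "?c $ n * to_fract (frob_diff n) = 0"
        using *[of n] by (simp add: to_fract_frob_diff algebra_simps)
      thus ?thesis using frob_diff_nonzero[of n, where 'f = 'f] False by simp
    qed (simp add: star_nth)
  qed
qed

lemma exp_log_series: "star exp_series log_series = 1"
proof (rule star_inj)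
  show "log_series $ 0 = 1" by simp
  have "star log_series 1 = log_series" using star_const_right_nth[of log_series 1] by (intro fps_ext) simp
  thus "star log_series (star exp_series log_series) = star log_series 1" by (simp add: log_exp_series flip: star_assoc)
qed

lemma star_log_exp [simp]: "star log_series (star exp_series F) = F"
  by (simp add: log_exp_series flip: star_assoc)

lemma star_exp_log [simp]: "star exp_series (star log_series F) = F"
  by (simp add: exp_log_series flip: star_assoc)

text \<open>
  The logarithm transports multiplication by \<open>A[T]\<close> on \<open>K[[T]]\<close> to the action of \<open>A[T]\<close> through
  \<open>\<phi>\<^sup>~\<close>; this extends the action to \<open>K[[T]]\<close>.
\<close>

definition act :: "'f poly fract fps \<Rightarrow> 'f poly fract fps \<Rightarrow> 'f poly fract fps" where
  "act c x = star exp_series (c * star log_series x)"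

lemma star_log_act: "star log_series (act c x) = c * star log_series x"
  by (simp add: act_def)

lemma act_mult: "act (c * d) x = act c (act d x)"
  by (simp add: act_def mult.assoc)

lemma act_add_left: "act (c + d) x = act c x + act d x"
  by (simp add: act_def distrib_right star_add_right)

lemma act_diff_left: "act (c - d) x = act c x - act d x"
  by (simp add: act_def left_diff_distrib star_diff_right)

lemma act_add_right: "act c (x + y) = act c x + act c y"
  by (simp add: act_def distrib_left star_add_right)

lemma act_sum_right: "act c (\<Sum>i\<in>I. f i) = (\<Sum>i\<in>I. act c (f i))"
  by (simp add: act_def sum_distrib_left star_sum_right)

lemma act_sum_left: "act (\<Sum>i\<in>I. f i) x = (\<Sum>i\<in>I. act (f i) x)"
  by (simp add: act_def sum_distrib_right star_sum_right)

lemma act_0_left [simp]: "act 0 x = 0" and act_0_right [simp]: "act c 0 = 0"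
  and act_1 [simp]: "act 1 x = x"
  by (simp_all add: act_def)

lemma act_frob_fixed: "frob_fixed h \<Longrightarrow> act h x = h * x"
  by (simp add: act_def star_frob_fixed_mult)

lemma act_frob_fixed_mult_left: "frob_fixed h \<Longrightarrow> act (h * c) x = h * act c x"
  by (simp add: act_mult act_frob_fixed)

lemma act_frob_fixed_mult_right: "frob_fixed h \<Longrightarrow> act c (h * x) = h * act c x"
  by (metis act_frob_fixed act_mult mult.commute)

text \<open>With T^i in the role of tau^i, \<open>star (emb phi_t)\<close> is the operator t + g_1 T
  tau + ... + g_r T^r tau^r, that is phi~_t on K[[T]]. This ties \<open>act\<close> to the twisted
  form.\<close>

lemma act_t: "act (fps_const fract_t) x = star (emb phi_t) x"
proof -
  have "act (fps_const fract_t) x = star (star exp_series (fps_const fract_t)) (star log_series x)"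
    by (simp add: act_def star_assoc)
  thus ?thesis by (simp add: exp_series_star star_assoc)
qed

lemma act_emb_pCons:
  "act (emb (pCons a P)) x = act (emb [:a:]) x + fps_X * act (emb P) x"
  by (simp add: emb_pCons act_add_left act_frob_fixed_mult_left)

lemma act_const_pCons:
  "act (emb [:pCons c a:]) x = fps_const (to_fract [:c:]) * x + star (emb phi_t) (act (emb [:a:]) x)"
proof -
  have "pCons c a = [:c:] + var_t * a" by simp
  hence "emb [:pCons c a:] = fps_const (to_fract [:c:]) + fps_const fract_t * emb [:a:]"
    unfolding emb_const by (simp only: to_fract_add to_fract_mult fps_const_add fps_const_mult)
  thus ?thesis by (simp add: act_add_left act_mult act_t act_frob_fixed)
qed

lemma star_phi_t_emb: "\<exists>Q. star (emb phi_t) (emb P) = emb Q"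
proof (rule emb_eqI[of _ "degree phi_t + degree P + 1"])
  fix n
  have "star (emb phi_t) (emb P) $ n =
      to_fract (\<Sum>i=0..n. coeff phi_t i * coeff P (n - i) ^ (CARD('f) ^ i))"
    by (simp add: star_nth)
  thus "star (emb phi_t) (emb P) $ n \<in> range to_fract" by blast
  assume n: "n \<ge> degree phi_t + degree P + 1"
  have "emb phi_t $ i * (emb P $ (n - i)) ^ (CARD('f) ^ i) = 0" for i
  proof (cases "i > degree phi_t")
    case False
    hence "n - i > degree P" using n by simp
    thus ?thesis by (simp add: coeff_eq_0 zero_power)
  qed (simp add: coeff_eq_0)
  thus "star (emb phi_t) (emb P) $ n = 0" unfolding star_nth by (simp only: sum.neutral_const)
qed

lemma act_const_emb: "\<exists>Q. act (emb [:a:]) (emb P) = emb Q"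
proof (induction a)
  case (pCons c a)
  then obtain Q where "act (emb [:a:]) (emb P) = emb Q" by blast
  moreover obtain R where "star (emb phi_t) (emb Q) = emb R" using star_phi_t_emb by blast
  ultimately have "act (emb [:pCons c a:]) (emb P) = emb ([:[:c:]:] * P + R)"
    unfolding act_const_pCons by (simp add: emb_add emb_mult emb_const del: mult_pCons_left)
  thus ?case by blast
qed (auto intro: exI[of _ 0])

text \<open>Although \<open>act\<close> is defined through log and exp, which have denominators, for
  c in A[T] it is built from F, T and phi~_t, and these preserve A[T].\<close>

lemma act_emb_emb: "\<exists>Q. act (emb c) (emb P) = emb Q"
proof (induction c)
  case (pCons a c)
  then obtain Q where "act (emb c) (emb P) = emb Q" by blast
  moreover obtain R where "act (emb [:a:]) (emb P) = emb R" using act_const_emb by blast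
  ultimately have "act (emb (pCons a c)) (emb P) = emb (R + pCons 0 Q)"
    by (subst act_emb_pCons) (simp add: emb_add emb_pCons)
  thus ?case by blast
qed (auto intro: exI[of _ 0])

text \<open>Evaluation at \<open>T = 1\<close> is compatible with the action, because \<open>T\<close> commutes with \<open>\<tau>\<close>.\<close>

lemma poly_1_act:
  assumes "act (emb c) (emb P) = emb Q" "act (emb [:poly c 1:]) (emb P) = emb R"
  shows "poly Q 1 = poly R 1"
  using assms
proof (induction c arbitrary: Q R)
  case 0
  thus ?case by simp
next
  case (pCons a c)
  obtain Q' where Q': "act (emb c) (emb P) = emb Q'" using act_emb_emb by blast
  obtain R' where R': "act (emb [:poly c 1:]) (emb P) = emb R'" using act_emb_emb by blast
  obtain S where S: "act (emb [:a:]) (emb P) = emb S" using act_emb_emb by blast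
  from pCons.prems(1) have "emb Q = emb S + fps_X * emb Q'"
    by (subst (asm) act_emb_pCons) (simp add: Q' S)
  also have "\<dots> = emb (S + pCons 0 Q')" by (simp add: emb_add emb_pCons)
  finally have "emb Q = emb (S + pCons 0 Q')" .
  hence Q: "Q = S + pCons 0 Q'" by (simp only: emb_eq_iff)
  have "[:poly (pCons a c) 1:] = [:a:] + [:poly c 1:]" by simp
  with pCons.prems(2) have "emb R = emb (S + R')"
    by (simp only: emb_add act_add_left S R')
  hence "R = S + R'" by (simp only: emb_eq_iff)
  with Q pCons.IH[OF Q' R'] show ?case by simp
qed

section \<open>Integrality at a place\<close>

context
  fixes p :: "'f poly"
  assumes p: "place p"
begin

interpretation filtration "vfil p" by (rule filtration_vfil[OF p])

lemma int_power_diff_ge: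
  "i > 0 \<Longrightarrow> m \<ge> 0 \<Longrightarrow> 2 * m \<le> int (CARD('f) ^ i) * m"
  using card_power_gt_1[of i, where 'f = 'f] by (intro mult_right_mono) linarith+

text \<open>Apart from t z, phi~_t involves only q-th or higher powers, and q \<ge> 2 doubles the
  valuation. These powers come from coefficients below n, so nothing is assumed on
  \<open>z $ n\<close> itself; \<open>act_inverse_W\<close> depends on that.\<close>

lemma star_phi_t_approx:
  assumes "m \<ge> 0" "\<And>i. i < n \<Longrightarrow> vfil p m (z $ i)"
  shows "vfil p (2 * m) (star (emb phi_t) z $ n - fract_t * z $ n)"
proof -
  have "star (emb phi_t) z $ n =
      fract_t * z $ n + (\<Sum>i=1..n. emb phi_t $ i * (z $ (n - i)) ^ (CARD('f) ^ i))"
    unfolding star_nth by (simp add: sum.atLeast_Suc_atMost coeff_phi_t_0)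
  moreover have "vfil p (2 * m) (\<Sum>i=1..n. emb phi_t $ i * (z $ (n - i)) ^ (CARD('f) ^ i))"
  proof (rule V_sum)
    fix i assume i: "i \<in> {1..n}"
    have "vfil p (2 * m) ((z $ (n - i)) ^ (CARD('f) ^ i))"
      using int_power_diff_ge[of i m] i assms by (intro V_power'[of m]) auto
    thus "vfil p (2 * m) (emb phi_t $ i * (z $ (n - i)) ^ (CARD('f) ^ i))"
      using vfil_0_to_fract[OF p] by (intro V_mult0) auto
  qed
  ultimately show ?thesis by simp
qed

lemma act_approx:
  assumes "m \<ge> 0" "\<And>i. i < n \<Longrightarrow> vfil p m (z $ i)"
  shows "vfil p (2 * m) (act (emb [:a:]) z $ n - to_fract a * z $ n)"
  using assms
proof (induction a arbitrary: n)
  case (pCons c a)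
  let ?w = "act (emb [:a:]) z"
  have w: "vfil p m (?w $ i)" if "i < n" for i
  proof -
    have "vfil p m (?w $ i - to_fract a * z $ i)"
      using pCons.IH[of i] pCons.prems that by (intro V_mono[of "2 * m" _ m]) auto
    moreover have "vfil p m (to_fract a * z $ i)"
      using pCons.prems that vfil_0_to_fract[OF p] by (intro V_mult0) auto
    ultimately have "vfil p m ((?w $ i - to_fract a * z $ i) + to_fract a * z $ i)" by (rule V_add)
    thus ?thesis by simp
  qed
  have "pCons c a = [:c:] + var_t * a" by simp
  hence e: "to_fract (pCons c a) = to_fract [:c:] + fract_t * to_fract a"
    by (metis to_fract_add to_fract_mult)
  have "act (emb [:pCons c a:]) z $ n - to_fract (pCons c a) * z $ n =
      (star (emb phi_t) ?w $ n - fract_t * ?w $ n) + fract_t * (?w $ n - to_fract a * z $ n)"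
    by (subst act_const_pCons) (simp add: e algebra_simps)
  also have "vfil p (2 * m) \<dots>"
    using star_phi_t_approx[of m n ?w] w pCons.IH[of n] pCons.prems vfil_0_to_fract[OF p]
    by (intro V_add V_mult0) auto
  finally show ?case .
qed simp

lemma act_const_W:
  assumes "m \<ge> 0" "W (\<lambda>_. m) z"
  shows "W (\<lambda>_. m) (act (emb [:a:]) z)"
  unfolding W_def
proof
  fix n
  have z: "vfil p m (z $ i)" for i using assms(2) by (simp add: W_def)
  have "vfil p m (act (emb [:a:]) z $ n - to_fract a * z $ n)"
    using act_approx[of m n z a] z assms(1) by (intro V_mono[of "2 * m" _ m]) auto
  moreover have "vfil p m (to_fract a * z $ n)"
    using z vfil_0_to_fract[OF p] by (intro V_mult0) auto
  ultimately have "vfil p m ((act (emb [:a:]) z $ n - to_fract a * z $ n) + to_fract a * z $ n)"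
    by (rule V_add)
  thus "vfil p m (act (emb [:a:]) z $ n)" by simp
qed

lemma X_mult_W:
  assumes "W (\<lambda>_. m) z"
  shows "W (\<lambda>_. m) (fps_X * z)"
  using assms by (simp add: W_def fps_X_mult_nth)

lemma act_emb_W:
  assumes "m \<ge> 0" "W (\<lambda>_. m) z"
  shows "W (\<lambda>_. m) (act (emb c) z)"
proof (induction c)
  case 0
  show ?case by (simp add: W_def)
next
  case (pCons a c)
  thus ?case using assms by (subst act_emb_pCons) (intro W_add X_mult_W act_const_W)
qed

text \<open>Division by b solves phi~_b(w) = z one coefficient at a time: b w_n is z_n up to an
  integral expression in earlier coefficients of w, and b is a unit at p.\<close>

lemma act_inverse_W:
  assumes "\<not> p dvd b" "W (\<lambda>_. 0) z"
  shows "W (\<lambda>_. 0) (act (fps_const (inverse (to_fract b))) z)"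
proof -
  let ?w = "act (fps_const (inverse (to_fract b))) z"
  have "b \<noteq> 0" using assms(1) by auto
  have "act (emb [:b:]) ?w = act (emb [:b:] * fps_const (inverse (to_fract b))) z"
    by (rule act_mult[symmetric])
  also have "emb [:b:] * fps_const (inverse (to_fract b)) = 1"
    using \<open>b \<noteq> 0\<close> by (simp add: emb_const)
  finally have z: "act (emb [:b:]) ?w = z" by simp
  have "vfil p 0 (?w $ n)" for n
  proof (induction n rule: less_induct)
    case (less n)
    have "vfil p 0 (z $ n - to_fract b * ?w $ n)"
      using act_approx[of 0 n ?w b] less z by simp
    moreover have "vfil p 0 (z $ n)" using assms(2) by (simp add: W_def)
    ultimately have "vfil p 0 (z $ n - (z $ n - to_fract b * ?w $ n))" by (metis V_diff)
    hence "vfil p 0 (to_fract b * ?w $ n)" by (simp only: diff_diff_eq2 add_diff_cancel_left')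
    hence "vfil p 0 (inverse (to_fract b) * (to_fract b * ?w $ n))"
      by (rule V_mult0[OF vfil_inverse[OF assms(1)]])
    thus ?case using \<open>b \<noteq> 0\<close> by (simp add: mult.assoc[symmetric])
  qed
  thus ?thesis by (simp add: W_def)
qed

lemma fps_decompose: "fps_const (c $ 0) + fps_X * fps_shift 1 c = c"
  for c :: "'f poly fract fps"
  by (rule fps_ext) (simp add: fps_X_mult_nth)

text \<open>A series acts through its constant term and T times the shifted rest; a constant a/b
  acts by phi~_a after division by b. As the shift changes c, the induction on the coefficient index
  has to treat all c at once.\<close>

lemma act_W:
  assumes "W (\<lambda>_. 0) c" "W (\<lambda>_. 0) z"
  shows "W (\<lambda>_. 0) (act c z)"
proof -
  have const: "W (\<lambda>_. 0) (act (fps_const x) z)" if x: "vfil p 0 x" for x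
  proof -
    from x obtain a b where ab: "\<not> p dvd b" "x = to_fract a / to_fract b"
      unfolding vfil_def by auto
    hence "fps_const x = emb [:a:] * fps_const (inverse (to_fract b))"
      by (simp add: emb_const divide_inverse)
    thus ?thesis using act_emb_W[OF _ act_inverse_W[OF ab(1) assms(2)], of "[:a:]"]
      by (simp add: act_mult)
  qed
  have "\<forall>c. W (\<lambda>_. 0) c \<longrightarrow> vfil p 0 (act c z $ n)" for n
  proof (induction n)
    case 0
    show ?case
    proof (intro allI impI)
      fix c :: "'f poly fract fps" assume c: "W (\<lambda>_. 0) c"
      have "act c z = act (fps_const (c $ 0) + fps_X * fps_shift 1 c) z"
        by (simp only: fps_decompose)
      also have "\<dots> = act (fps_const (c $ 0)) z + fps_X * act (fps_shift 1 c) z"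
        by (simp add: act_add_left act_frob_fixed_mult_left)
      finally show "vfil p 0 (act c z $ 0)" using const[of "c $ 0"] c by (simp add: W_def)
    qed
  next
    case (Suc n)
    show ?case
    proof (intro allI impI)
      fix c :: "'f poly fract fps" assume c: "W (\<lambda>_. 0) c"
      have "act c z = act (fps_const (c $ 0) + fps_X * fps_shift 1 c) z"
        by (simp only: fps_decompose)
      also have "\<dots> = act (fps_const (c $ 0)) z + fps_X * act (fps_shift 1 c) z"
        by (simp add: act_add_left act_frob_fixed_mult_left)
      finally have "act c z $ Suc n = act (fps_const (c $ 0)) z $ Suc n + act (fps_shift 1 c) z $ n"
        by simp
      thus "vfil p 0 (act c z $ Suc n)"
        using Suc const[of "c $ 0"] c by (simp add: W_def V_add)
    qed
  qed
  thus ?thesis using assms(1) by (auto simp: W_def)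
qed

text \<open>Each step of the recursion divides by a squarefree polynomial and so costs at most one
  factor p.\<close>

lemma log_coeff_vfil: "vfil p (- int n) (log_coeff n)"
proof (induction n rule: less_induct)
  case (less n)
  show ?case
  proof (cases "n = 0")
    case False
    have "vfil p (1 - int n) (- (\<Sum>i<n. log_coeff i * (emb phi_t $ (n - i)) ^ (CARD('f) ^ i)))"
    proof (intro V_minus V_sum)
      fix i assume "i \<in> {..<n}"
      moreover have "vfil p 0 ((emb phi_t $ (n - i)) ^ (CARD('f) ^ i))"
        using V_power[OF vfil_0_to_fract[OF p], of "CARD('f) ^ i"] by simp
      ultimately show "vfil p (1 - int n) (log_coeff i * (emb phi_t $ (n - i)) ^ (CARD('f) ^ i))"
        using less[of i] by (intro V_mult'[of "- int i" _ 0]) auto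
    qed
    moreover have "vfil p (- 1) (inverse (to_fract (frob_diff n)))"
      using False frob_diff_squarefree[OF p] by (intro vfil_inverse_squarefree p) auto
    ultimately show ?thesis
      using False by (subst log_coeff.simps) (auto simp del: mult_minus_left intro!: V_mult'[of "1 - int n" _ "- 1"])
  qed simp
qed

text \<open>At a place dividing none of the first M brackets the recursion never divides by p. This
  covers all but finitely many places and is the source of convergence of the Euler product.\<close>

lemma log_coeff_integral:
  assumes "\<And>k. 0 < k \<Longrightarrow> k \<le> M \<Longrightarrow> \<not> p dvd frob_diff k" "n \<le> M"
  shows "vfil p 0 (log_coeff n)"
  using assms(2)
proof (induction n rule: less_induct)
  case (less n)
  show ?case
  proof (cases "n = 0")
    case False
    have "vfil p 0 (- (\<Sum>i<n. log_coeff i * (emb phi_t $ (n - i)) ^ (CARD('f) ^ i)))"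
    proof (intro V_minus V_sum)
      fix i assume "i \<in> {..<n}"
      moreover have "vfil p 0 ((emb phi_t $ (n - i)) ^ (CARD('f) ^ i))"
        using V_power[OF vfil_0_to_fract[OF p], of "CARD('f) ^ i"] by simp
      ultimately show "vfil p 0 (log_coeff i * (emb phi_t $ (n - i)) ^ (CARD('f) ^ i))"
        using less by (intro V_mult0) auto
    qed
    moreover have "vfil p 0 (inverse (to_fract (frob_diff n)))"
      using False less.prems by (intro vfil_inverse assms(1)) auto
    ultimately show ?thesis
      using False by (subst log_coeff.simps) (auto simp del: mult_minus_left intro!: V_mult0)
  qed simp
qed

end

end

section \<open>The characteristic polynomial at a place\<close>

text \<open>T has weight 1 and t has weight r. A determinant of size d with entries of weight at
  most r has weight at most d r, which bounds the degree of its coefficient at T^n by d - n/r. Zero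
  coefficients are exempt because their \<open>degree\<close> is 0.\<close>

definition wdeg_le :: "nat \<Rightarrow> nat \<Rightarrow> 'f::field poly poly \<Rightarrow> bool" where
  "wdeg_le r m F \<longleftrightarrow> (\<forall>k. coeff F k = 0 \<or> k + r * degree (coeff F k) \<le> m)"

lemma wdeg_le_0 [simp]: "wdeg_le r m 0"
  by (simp add: wdeg_le_def)

lemma wdeg_le_1 [simp]: "wdeg_le r m 1"
  by (auto simp: wdeg_le_def coeff_1)

lemma wdeg_le_add:
  assumes "wdeg_le r m F" "wdeg_le r m G"
  shows "wdeg_le r m (F + G)"
  unfolding wdeg_le_def
proof
  fix k
  show "coeff (F + G) k = 0 \<or> k + r * degree (coeff (F + G) k) \<le> m"
  proof (cases "coeff F k = 0 \<or> coeff G k = 0")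
    case False
    have "degree (coeff F k + coeff G k) \<le> max (degree (coeff F k)) (degree (coeff G k))"
      by (rule degree_add_le_max)
    hence "r * degree (coeff F k + coeff G k) \<le> r * degree (coeff F k) \<or>
           r * degree (coeff F k + coeff G k) \<le> r * degree (coeff G k)"
      by (auto simp: max_def split: if_splits)
    moreover have "k + r * degree (coeff F k) \<le> m" "k + r * degree (coeff G k) \<le> m"
      using False assms by (auto simp: wdeg_le_def)
    ultimately have "k + r * degree (coeff F k + coeff G k) \<le> m" by linarith
    thus ?thesis by simp
  qed (use assms in \<open>auto simp: wdeg_le_def\<close>)
qed

lemma wdeg_le_minus: "wdeg_le r m F \<Longrightarrow> wdeg_le r m (- F)"
  by (simp add: wdeg_le_def)

lemma wdeg_le_sum: "(\<And>i. i \<in> I \<Longrightarrow> wdeg_le r m (f i)) \<Longrightarrow> wdeg_le r m (\<Sum>i\<in>I. f i)"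
  by (induction I rule: infinite_finite_induct) (simp_all add: wdeg_le_add)

lemma wdeg_le_coeff_sum:
  fixes f :: "'a \<Rightarrow> 'f::field poly"
  assumes "\<And>i. i \<in> I \<Longrightarrow> f i = 0 \<or> k + r * degree (f i) \<le> m"
  shows "(\<Sum>i\<in>I. f i) = 0 \<or> k + r * degree (\<Sum>i\<in>I. f i) \<le> m"
proof -
  \<comment> \<open>Placed at T^k, the summands turn the claim into one on weights of sums.\<close>
  have "wdeg_le r m (\<Sum>i\<in>I. monom (f i) k)"
    using assms by (intro wdeg_le_sum) (auto simp: wdeg_le_def)
  thus ?thesis by (auto simp: wdeg_le_def coeff_sum dest: spec[of _ k])
qed

lemma wdeg_le_mult:
  assumes "wdeg_le r m F" "wdeg_le r n G"
  shows "wdeg_le r (m + n) (F * G)"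
  unfolding wdeg_le_def coeff_mult
proof
  fix k
  show "(\<Sum>i\<le>k. coeff F i * coeff G (k - i)) = 0 \<or>
        k + r * degree (\<Sum>i\<le>k. coeff F i * coeff G (k - i)) \<le> m + n"
  proof (rule wdeg_le_coeff_sum)
    fix i assume i: "i \<in> {..k}"
    show "coeff F i * coeff G (k - i) = 0 \<or> k + r * degree (coeff F i * coeff G (k - i)) \<le> m + n"
    proof (cases "coeff F i = 0 \<or> coeff G (k - i) = 0")
      case False
      hence "i + r * degree (coeff F i) \<le> m" "(k - i) + r * degree (coeff G (k - i)) \<le> n"
        using assms by (auto simp: wdeg_le_def)
      thus ?thesis using False i by (simp add: degree_mult_eq algebra_simps)
    qed auto
  qed
qed

lemma wdeg_le_prod:
  assumes "finite I" "\<And>i. i \<in> I \<Longrightarrow> wdeg_le r m (f i)"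
  shows "wdeg_le r (card I * m) (\<Prod>i\<in>I. f i)"
  using assms
proof (induction I rule: finite_induct)
  case (insert x I)
  have "wdeg_le r (m + card I * m) (f x * (\<Prod>i\<in>I. f i))"
    using insert by (intro wdeg_le_mult) auto
  thus ?case using insert.hyps by simp
qed simp

lemma wdeg_le_det:
  assumes N: "N \<in> carrier_mat d d" and "\<And>i j. i < d \<Longrightarrow> j < d \<Longrightarrow> wdeg_le r m (N $$ (i, j))"
  shows "wdeg_le r (d * m) (det N)"
  unfolding det_def'[OF N]
proof (rule wdeg_le_sum)
  fix s assume "s \<in> {s. s permutes {0..<d}}"
  hence s: "s i < d" if "i < d" for i using that permutes_in_image by fastforce
  have "wdeg_le r (card {0..<d} * m) (\<Prod>i=0..<d. N $$ (i, s i))"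
    using s assms(2) by (intro wdeg_le_prod) auto
  moreover have "wdeg_le r 0 (signof s :: 'a poly poly)"
    by (auto simp: sign_def wdeg_le_minus)
  ultimately have "wdeg_le r (0 + card {0..<d} * m) (signof s * (\<Prod>i=0..<d. N $$ (i, s i)))"
    by (intro wdeg_le_mult)
  thus "wdeg_le r (d * m) (signof s * (\<Prod>i=0..<d. N $$ (i, s i)))" by simp
qed

section \<open>Coordinates on the residue field\<close>

lemma frob_T_power_coeff:
  "coeff ((frob_T ^^ i) x) k = coeff (x :: 'f::{field,finite} poly poly) k ^ (CARD('f) ^ i)"
proof (induction i)
  case (Suc i)
  have "frob (0 :: 'f poly) = 0" by (simp add: frob_def)
  with Suc show ?case
    by (simp add: frob_T_def coeff_map_poly) (simp add: frob_def power_mult[symmetric] mult.commute)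
qed simp

lemma degree_mod_less_place:
  assumes "place p"
  shows "degree (c mod p) < degree p"
  using degree_mod_less'[of p c] place_nonzero[OF assms] place_degree[OF assms]
  by (cases "c mod p = 0") auto

lemma poly_sum_monom_less:
  fixes c :: "'f::field poly"
  assumes "degree c < d"
  shows "(\<Sum>k<d. [:coeff c k:] * var_t ^ k) = c"
proof -
  have "(\<Sum>k<d. [:coeff c k:] * var_t ^ k) = (\<Sum>k\<le>d - 1. monom (coeff c k) k)"
    using assms by (intro sum.cong) (auto simp: monom_altdef)
  also have "\<dots> = c" using assms by (intro poly_as_sum_of_monoms') auto
  finally show ?thesis .
qed

text \<open>Its values have coefficients in F and hence commute with tau; this makes the expansion
  in powers of t compatible with \<open>act\<close>.\<close>

definition coord :: "nat \<Rightarrow> 'f::{field,finite} poly poly \<Rightarrow> 'f poly poly" where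
  "coord k = map_poly (\<lambda>c. [:coeff c k:])"

lemma coeff_coord [simp]: "coeff (coord k y) n = [:coeff (coeff y n) k:]"
  by (simp add: coord_def coeff_map_poly)

lemma frob_fixed_coord [simp]: "frob_fixed (emb (coord k (y :: 'f::{field,finite} poly poly)))"
  unfolding frob_fixed_def using power_card_power_const[of _ 1, where 'f = 'f] by simp

lemma sum_coord:
  fixes y :: "'f::{field,finite} poly poly"
  assumes "\<And>n. degree (coeff y n) < d"
  shows "(\<Sum>k<d. coord k y * [:var_t ^ k:]) = y"
proof (rule poly_eqI)
  fix n
  have "coeff (\<Sum>k<d. coord k y * [:var_t ^ k:]) n = (\<Sum>k<d. [:coeff (coeff y n) k:] * var_t ^ k)"
    by (simp add: coeff_sum mult.commute del: mult_pCons_left)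
  also have "\<dots> = coeff y n" by (rule poly_sum_monom_less[OF assms])
  finally show "coeff (\<Sum>k<d. coord k y * [:var_t ^ k:]) n = coeff y n" .
qed

context drinfeld
begin

lemma coeff_twisted_act:
  "coeff (twisted_act (twisted_form \<phi> var_t) x) n =
     (\<Sum>i=0..n. coeff phi_t i * coeff x (n - i) ^ (CARD('f) ^ i))"
proof -
  let ?f = "twisted_form \<phi> var_t"
  let ?h = "\<lambda>i. coeff phi_t i * coeff x (n - i) ^ (CARD('f) ^ i)"
  have "coeff (twisted_act ?f x) n = (\<Sum>i\<le>degree ?f. if i \<le> n then ?h i else 0)"
    unfolding twisted_act_def coeff_sum coeff_twisted_form
    by (intro sum.cong refl) (auto simp: coeff_monom_mult frob_T_power_coeff phi_t_def)
  also have "\<dots> = (\<Sum>i\<in>{..degree ?f} \<inter> {..n}. ?h i)"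
    using sum.inter_restrict[of "{..degree ?f}" ?h "{..n}"] by simp
  also have "\<dots> = (\<Sum>i\<in>{0..n}. ?h i)"
  proof (rule sum.mono_neutral_left)
    show "\<forall>i\<in>{0..n} - {..degree ?f} \<inter> {..n}. ?h i = 0"
    proof
      fix i assume "i \<in> {0..n} - {..degree ?f} \<inter> {..n}"
      hence "coeff ?f i = 0" by (intro coeff_eq_0) auto
      thus "?h i = 0" by (simp add: coeff_twisted_form phi_t_def)
    qed
  qed auto
  finally show ?thesis .
qed

lemma emb_twisted_act: "emb (twisted_act (twisted_form \<phi> var_t) x) = star (emb phi_t) (emb x)"
  by (rule fps_ext) (simp add: coeff_twisted_act star_nth)

definition img :: "'f poly \<Rightarrow> nat \<Rightarrow> 'f poly poly" where
  "img p j = residue_act p (twisted_form \<phi> var_t) [:var_t ^ j:]"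

lemma coeff_img:
  "coeff (img p j) n = coeff (twisted_act (twisted_form \<phi> var_t) [:var_t ^ j:]) n mod p"
  by (simp add: img_def residue_act_def coeff_map_poly)

lemma local_matrix_entry:
  "k < degree p \<Longrightarrow> j < degree p \<Longrightarrow>
     local_matrix \<phi> p $$ (k, j) = (if k = j then [:var_t:] else 0) - coord k (img p j)"
  by (simp add: local_matrix_def img_def coord_def)

lemma local_matrix_carrier: "local_matrix \<phi> p \<in> carrier_mat (degree p) (degree p)"
  by (simp add: local_matrix_def)

lemma wdeg_le_residue_size: "wdeg_le rk (degree p * rk) (residue_size \<phi> p)"
  unfolding residue_size_def
proof (rule wdeg_le_det[OF local_matrix_carrier])
  fix k j assume kj: "k < degree p" "j < degree p"
  have "wdeg_le rk rk (coord k (img p j))"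
    unfolding wdeg_le_def
  proof
    fix n
    show "coeff (coord k (img p j)) n = 0 \<or> n + rk * degree (coeff (coord k (img p j)) n) \<le> rk"
    proof (cases "n \<le> rk")
      case False
      \<comment> \<open>A constant in T meets only the term g_n T^n tau^n, which is absent for n >
        r.\<close>
      have "coeff (twisted_act (twisted_form \<phi> var_t) [:var_t ^ j:]) n =
          (\<Sum>i\<in>{n}. coeff phi_t i * coeff [:var_t ^ j:] (n - i) ^ (CARD('f) ^ i))"
        unfolding coeff_twisted_act
        by (intro sum.mono_neutral_right) (auto simp: coeff_pCons zero_power split: nat.splits)
      also have "\<dots> = 0" using False by (simp add: coeff_eq_0 rk_def)
      finally show ?thesis by (simp add: coeff_img)
    qed simp
  qed
  moreover have "wdeg_le rk rk (if k = j then [:var_t:] else 0 :: 'f poly poly)"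
    by (auto simp: wdeg_le_def coeff_pCons split: nat.splits)
  ultimately have "wdeg_le rk rk ((if k = j then [:var_t:] else 0) + (- coord k (img p j)))"
    by (intro wdeg_le_add wdeg_le_minus)
  thus "wdeg_le rk rk (local_matrix \<phi> p $$ (k, j))" by (simp add: local_matrix_entry kj)
qed

text \<open>At T = 0 the matrix becomes t - B with B over F, so its determinant is a characteristic
  polynomial. That it equals p for a place p is the content of \<open>residue_size_coeff_0\<close>,
  which adds divisibility by p.\<close>

lemma residue_size_coeff_0_monic:
  "degree (coeff (residue_size \<phi> p) 0) = degree p \<and> coeff (coeff (residue_size \<phi> p) 0) (degree p) = 1"
proof -
  let ?d = "degree p"
  define B where "B = mat ?d ?d (\<lambda>(k, j). coeff (coeff (img p j) 0) k)"
  interpret h: comm_ring_hom "\<lambda>F :: 'f poly poly. coeff F 0"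
    by unfold_locales (auto simp: coeff_mult_0)
  have B: "B \<in> carrier_mat ?d ?d" by (simp add: B_def)
  have "map_mat (\<lambda>F. coeff F 0) (local_matrix \<phi> p) = char_poly_matrix B"
  proof (rule eq_matI)
    fix k j assume "k < dim_row (char_poly_matrix B)" "j < dim_col (char_poly_matrix B)"
    hence kj: "k < ?d" "j < ?d" using B by (auto simp: char_poly_matrix_def)
    hence "k < dim_row (local_matrix \<phi> p)" "j < dim_col (local_matrix \<phi> p)"
      by (simp_all add: local_matrix_def)
    thus "map_mat (\<lambda>F. coeff F 0) (local_matrix \<phi> p) $$ (k, j) = char_poly_matrix B $$ (k, j)"
      using kj by (simp add: local_matrix_entry char_poly_matrix_def B_def)
  qed (simp_all add: local_matrix_def char_poly_matrix_def B_def)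
  hence "coeff (residue_size \<phi> p) 0 = char_poly B"
    unfolding residue_size_def char_poly_def by (metis h.hom_det)
  thus ?thesis using degree_monic_char_poly[OF B] by simp
qed

lemma residue_size_coeff_bound:
  "coeff (residue_size \<phi> p) n = 0 \<or> n + rk * degree (coeff (residue_size \<phi> p) n) \<le> rk * degree p"
  using wdeg_le_residue_size[of p] by (simp add: wdeg_le_def mult.commute)

lemma residue_size_coeff_degree:
  assumes "n > 0" "coeff (residue_size \<phi> p) n \<noteq> 0"
  shows "degree (coeff (residue_size \<phi> p) n) < degree p"
proof -
  have "rk * degree (coeff (residue_size \<phi> p) n) < rk * degree p"
    using residue_size_coeff_bound[of p n] assms by linarith
  thus ?thesis by simp
qed

text \<open>Only the coefficient of T^0 reaches degree d = deg p in t, so the term t^d survives at T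
  = 1. The value at 1 can therefore serve as a factor of the nonzero multiplier a in the torsion
  criterion.\<close>

lemma residue_size_at_1_nonzero: "poly (residue_size \<phi> p) 1 \<noteq> 0"
proof -
  let ?c = "residue_size \<phi> p"
  have z: "coeff (coeff ?c n) (degree p) = 0" if "n > 0" for n
    using residue_size_coeff_degree[of n p] that by (cases "coeff ?c n = 0") (auto intro: coeff_eq_0)
  have "coeff (poly ?c 1) (degree p) = (\<Sum>n\<le>degree ?c. coeff (coeff ?c n) (degree p))"
    by (simp add: poly_altdef coeff_sum)
  also have "\<dots> = (\<Sum>n\<in>{0}. coeff (coeff ?c n) (degree p))"
    using z by (intro sum.mono_neutral_right) auto
  also have "\<dots> = 1" using residue_size_coeff_0_monic[of p] by simp
  finally show ?thesis by auto
qed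

context
  fixes p :: "'f poly"
  assumes p: "place p"
begin

interpretation filtration "vfil p" by (rule filtration_vfil[OF p])

lemma W_mod: "(\<And>n. p dvd coeff F n - coeff G n) \<Longrightarrow> W (\<lambda>_. 1) (emb F - emb G)"
  unfolding W_def by (simp add: vfil_1_to_fract[OF p] flip: to_fract_diff)

text \<open>
  Cayley-Hamilton: the columns of the local matrix are relations modulo \<open>p\<close> between the basis
  elements \<open>t\<^sup>k\<close>, and the adjugate turns them into the relations \<open>|\<phi>\<^sup>~(\<bbbF>\<^sub>p)| t\<^sup>k = 0\<close>.
\<close>

lemma act_residue_size_basis:
  assumes i: "i < degree p"
  shows "W (\<lambda>_. 1) (act (emb (residue_size \<phi> p)) (emb [:var_t ^ i:]))"
proof -
  let ?d = "degree p" and ?N = "local_matrix \<phi> p"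
  let ?A = "adj_mat ?N"
  define r where "r j = (\<Sum>k<?d. act (emb (?N $$ (k, j))) (emb [:var_t ^ k:]))" for j
  note adj = adj_mat[OF local_matrix_carrier[of p]]
  have prod: "(\<Sum>j<?d. ?N $$ (k, j) * ?A $$ (j, i)) = (if k = i then residue_size \<phi> p else 0)"
    if k: "k < ?d" for k
  proof -
    have "(?N * ?A) $$ (k, i) = (\<Sum>j<?d. ?N $$ (k, j) * ?A $$ (j, i))"
      using k i adj(1) local_matrix_carrier[of p]
      by (auto simp: times_mat_def scalar_prod_def lessThan_atLeast0 intro!: sum.cong)
    hence "(\<Sum>j<?d. ?N $$ (k, j) * ?A $$ (j, i)) = (det ?N \<cdot>\<^sub>m 1\<^sub>m ?d) $$ (k, i)"
      by (simp only: adj(2))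
    thus ?thesis using k i by (simp add: residue_size_def)
  qed
  \<comment> \<open>The diagonal entry contributes phi~_t(t^j), the coordinates its reduction modulo
    p; the difference is divisible by p.\<close>
  have r: "W (\<lambda>_. 1) (r j)" if j: "j < ?d" for j
  proof -
    let ?T = "twisted_act (twisted_form \<phi> var_t) [:var_t ^ j:]"
    have "r j = (\<Sum>k<?d. (if k = j then act (fps_const fract_t) (emb [:var_t ^ k:]) else 0) -
        emb (coord k (img p j)) * emb [:var_t ^ k:])"
      unfolding r_def using j
      by (intro sum.cong refl)
         (simp add: local_matrix_entry emb_diff act_diff_left act_frob_fixed emb_const)
    also have "\<dots> = star (emb phi_t) (emb [:var_t ^ j:]) -
        emb (\<Sum>k<?d. coord k (img p j) * [:var_t ^ k:])"
      using j by (simp add: sum_subtractf act_t emb_sum emb_mult del: mult_pCons_right)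
    also have "(\<Sum>k<?d. coord k (img p j) * [:var_t ^ k:]) = img p j"
      by (rule sum_coord) (simp add: coeff_img degree_mod_less_place[OF p])
    also have "star (emb phi_t) (emb [:var_t ^ j:]) = emb ?T" by (simp add: emb_twisted_act)
    also have "W (\<lambda>_. 1) (emb ?T - emb (img p j))"
      by (rule W_mod) (simp add: coeff_img mod_eq_dvd_iff[symmetric])
    finally show ?thesis .
  qed
  have "act (emb (residue_size \<phi> p)) (emb [:var_t ^ i:]) =
      (\<Sum>k<?d. act (emb (\<Sum>j<?d. ?N $$ (k, j) * ?A $$ (j, i))) (emb [:var_t ^ k:]))"
    using i by (simp add: prod if_distrib[of emb] if_distribR sum.delta cong: if_cong)
       (simp add: if_distrib[of "\<lambda>c. act c _"] cong: if_cong)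
  also have "\<dots> = (\<Sum>k<?d. \<Sum>j<?d. act (emb (?A $$ (j, i))) (act (emb (?N $$ (k, j))) (emb [:var_t ^ k:])))"
    by (simp add: emb_sum emb_mult act_sum_left mult.commute flip: act_mult)
  also have "\<dots> = (\<Sum>j<?d. act (emb (?A $$ (j, i))) (r j))"
    unfolding r_def by (subst sum.swap) (simp add: act_sum_right)
  also have "W (\<lambda>_. 1) \<dots>" using r by (intro W_sum act_emb_W p) auto
  finally show ?thesis .
qed

text \<open>Modulo p every P is a combination of the t^k, k < deg p, with coefficients in F[T], over
  which the action is linear.\<close>

lemma act_residue_size: "W (\<lambda>_. 1) (act (emb (residue_size \<phi> p)) (emb P))"
proof -
  let ?R = "map_poly (\<lambda>c. c mod p) P" and ?d = "degree p"
  let ?c = "emb (residue_size \<phi> p)"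
  have R: "coeff ?R n = coeff P n mod p" for n by (simp add: coeff_map_poly)
  have "W (\<lambda>_. 1) (emb P - emb ?R)"
    by (rule W_mod) (simp add: R mod_eq_dvd_iff[symmetric])
  hence "W (\<lambda>_. 1) (act ?c (emb P - emb ?R))" by (intro act_emb_W p) auto
  moreover have "W (\<lambda>_. 1) (act ?c (emb ?R))"
  proof -
    have "emb ?R = emb (\<Sum>k<?d. coord k ?R * [:var_t ^ k:])"
      by (subst sum_coord) (simp_all add: R degree_mod_less_place[OF p])
    hence "act ?c (emb ?R) = (\<Sum>k<?d. emb (coord k ?R) * act ?c (emb [:var_t ^ k:]))"
      by (simp add: emb_sum emb_mult act_sum_right act_frob_fixed_mult_right del: mult_pCons_right)
    moreover have "W (\<lambda>_. 0) (emb F)" for F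
      by (simp add: W_def vfil_0_to_fract[OF p])
    ultimately show ?thesis
      using act_residue_size_basis
      by (auto intro!: W_sum intro: W_mult[where a = "\<lambda>_. 0" and b = "\<lambda>_. 1"])
  qed
  ultimately have "W (\<lambda>_. 1) (act ?c (emb P - emb ?R) + act ?c (emb ?R))" by (rule W_add)
  thus ?thesis by (simp flip: act_add_right)
qed

end

end

section \<open>The Euler product\<close>

lemma finite_polys_degree_le: "finite {p :: 'f::{field,finite} poly. degree p \<le> n}"
proof (rule finite_subset)
  show "{p :: 'f poly. degree p \<le> n} \<subseteq> Poly ` {xs. set xs \<subseteq> UNIV \<and> length xs \<le> n + 1}"
  proof
    fix p :: "'f poly" assume "p \<in> {p. degree p \<le> n}"
    hence "length (coeffs p) \<le> n + 1" by (cases "p = 0") (auto simp: length_coeffs)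
    moreover have "p = Poly (coeffs p)" by simp
    ultimately show "p \<in> Poly ` {xs. set xs \<subseteq> UNIV \<and> length xs \<le> n + 1}" by blast
  qed
qed (intro finite_imageI finite_lists_length_le finite)

lemma fps_mult_nth_trivial:
  fixes F G :: "'a::comm_ring_1 fps"
  assumes "F $ 0 = 1" "\<And>i. 0 < i \<Longrightarrow> i \<le> n \<Longrightarrow> F $ i = 0" "m \<le> n"
  shows "(F * G) $ m = G $ m"
proof -
  have "(F * G) $ m = (\<Sum>i\<in>{0}. F $ i * G $ (m - i))"
    unfolding fps_mult_nth using assms by (intro sum.mono_neutral_right) auto
  thus ?thesis using assms(1) by simp
qed

context drinfeld
begin

definition euler_factor :: "'f poly \<Rightarrow> 'f poly fract fps" where
  "euler_factor p = fps_of_poly (local_factor \<phi> p)"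

lemma euler_factor_eq: "euler_factor p = fps_const (inverse (to_fract p)) * emb (residue_size \<phi> p)"
  by (rule fps_ext) (simp add: euler_factor_def local_factor_def coeff_map_poly)

lemma euler_factor_nth: "euler_factor p $ n = inverse (to_fract p) * to_fract (coeff (residue_size \<phi> p) n)"
  by (simp add: euler_factor_eq)

lemma star_log_1 [simp]: "star log_series 1 = log_series"
  using star_const_right_nth[of log_series 1] by (intro fps_ext) simp

lemma euler_factor_mult: "place p \<Longrightarrow> fps_const (to_fract p) * (euler_factor p * F) = emb (residue_size \<phi> p) * F"
  using place_nonzero[of p] by (simp add: euler_factor_eq flip: mult.assoc)

context
  fixes p :: "'f poly"
  assumes p: "place p"
begin

interpretation filtration "vfil p" by (rule filtration_vfil[OF p])

text \<open>The i-th term has valuation at least q^i - i, which is 1 for i = 0 and at least i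
  otherwise.\<close>

lemma star_log_W:
  assumes "W (\<lambda>_. 1) y"
  shows "W (\<lambda>_. 1) (star log_series y)"
  unfolding W_def star_nth
proof (intro allI V_sum)
  fix n i
  have "vfil p (int (CARD('f) ^ i)) ((y $ (n - i)) ^ (CARD('f) ^ i))"
    using assms by (intro V_power'[of 1]) (auto simp: W_def)
  moreover have "int (2 * i) \<le> int (CARD('f) ^ i)"
    by (simp only: of_nat_le_iff card_power_ge)
  hence "1 \<le> - int i + int (CARD('f) ^ i)" by (cases "i = 0") simp_all
  ultimately show "vfil p 1 (log_series $ i * (y $ (n - i)) ^ (CARD('f) ^ i))"
    using log_coeff_vfil[OF p, of i] by (intro V_mult'[of "- int i"]) auto
qed

lemma residue_size_mult_log: "W (\<lambda>_. 1) (emb (residue_size \<phi> p) * log_series)"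
proof -
  have "emb (residue_size \<phi> p) * log_series = star log_series (act (emb (residue_size \<phi> p)) (emb 1))"
    by (simp add: star_log_act)
  also have "W (\<lambda>_. 1) \<dots>" by (intro star_log_W act_residue_size p)
  finally show ?thesis .
qed

text \<open>The product of |phi~(F_p)| and log(1) is divisible by p. Up to T^M the series log(1) is
  integral with constant term 1, so divisibility passes to the coefficients of the other factor in
  turn.\<close>

lemma place_dvd_residue_size_coeff:
  assumes "\<And>k. 0 < k \<Longrightarrow> k \<le> M \<Longrightarrow> \<not> p dvd frob_diff k" "n \<le> M"
  shows "p dvd coeff (residue_size \<phi> p) n"
proof -
  let ?c = "emb (residue_size \<phi> p)"
  have "vfil p 1 (?c $ n)"
    using assms(2)
  proof (induction n rule: less_induct)
    case (less n)
    have "(?c * log_series) $ n = ?c $ n + (\<Sum>j<n. ?c $ j * log_coeff (n - j))"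
      unfolding fps_mult_nth atLeast0AtMost by (simp add: lessThan_Suc_atMost[symmetric])
    hence "?c $ n = (?c * log_series) $ n - (\<Sum>j<n. ?c $ j * log_coeff (n - j))" by simp
    also have "vfil p 1 \<dots>"
    proof (intro V_diff V_sum)
      show "vfil p 1 ((?c * log_series) $ n)" using residue_size_mult_log by (simp only: W_def)
      fix j assume "j \<in> {..<n}"
      thus "vfil p 1 (?c $ j * log_coeff (n - j))"
        using less log_coeff_integral[OF p assms(1), of M "n - j"] by (intro V_mult'[of 1 _ 0]) auto
    qed
    finally show ?case .
  qed
  thus ?thesis by (simp add: vfil_1_to_fract[OF p])
qed

lemma residue_size_coeff_0: "coeff (residue_size \<phi> p) 0 = p"
proof -
  let ?c = "coeff (residue_size \<phi> p) 0"
  note mon = residue_size_coeff_0_monic[of p]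
  have "p dvd ?c" using place_dvd_residue_size_coeff[of 0 0] by simp
  then obtain d where d: "?c = p * d" by (rule dvdE)
  from mon have "?c \<noteq> 0" by (metis coeff_0 zero_neq_one)
  hence "p \<noteq> 0" "d \<noteq> 0" using d by auto
  with mon d have "degree d = 0" by (metis degree_mult_eq add_cancel_right_right)
  then obtain c where c: "d = [:c:]" by (auto elim: degree_eq_zeroE)
  have "coeff p (degree p) = 1" using p by (simp add: place_def)
  with mon d c have "c = 1" by simp
  with d c show ?thesis by simp
qed

lemma euler_factor_0 [simp]: "euler_factor p $ 0 = 1"
  using place_nonzero[OF p] by (simp add: euler_factor_nth residue_size_coeff_0)

text \<open>The coefficient of T^n in |phi~(F_p)| is divisible by p, but for n > 0 its degree is
  less than deg p.\<close>

lemma euler_factor_trivial: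
  assumes "\<And>k. 0 < k \<Longrightarrow> k \<le> M \<Longrightarrow> \<not> p dvd frob_diff k" "n \<le> M" "n > 0"
  shows "euler_factor p $ n = 0"
proof -
  have "coeff (residue_size \<phi> p) n = 0"
  proof (rule ccontr)
    assume nz: "coeff (residue_size \<phi> p) n \<noteq> 0"
    have "p dvd coeff (residue_size \<phi> p) n"
      using place_dvd_residue_size_coeff[OF assms(1,2)] .
    hence "degree p \<le> degree (coeff (residue_size \<phi> p) n)" using nz by (intro dvd_imp_degree_le)
    thus False using residue_size_coeff_degree[OF assms(3) nz] by simp
  qed
  thus ?thesis by (simp add: euler_factor_nth)
qed

lemma euler_factor_mult_log_W: "W (\<lambda>_. 0) (euler_factor p * log_series)"
  unfolding W_def
proof
  fix n
  have "(euler_factor p * log_series) $ n = inverse (to_fract p) * (emb (residue_size \<phi> p) * log_series) $ n"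
    by (simp add: euler_factor_eq mult.assoc)
  also have "vfil p 0 \<dots>"
    using residue_size_mult_log vfil_inverse_place[OF p]
    by (intro V_mult'[of "- 1" _ 1]) (auto simp: W_def simp del: fps_mult_nth)
  finally show "vfil p 0 ((euler_factor p * log_series) $ n)" .
qed

lemma euler_factor_W_other:
  assumes "place q" "q \<noteq> p"
  shows "W (\<lambda>_. 0) (euler_factor q)"
  unfolding W_def
proof
  fix n
  have "\<not> p dvd q" using place_dvd_monic[OF p assms(1)] assms(2) by auto
  thus "vfil p 0 (euler_factor q $ n)"
    unfolding euler_factor_nth by (intro V_mult0 vfil_inverse vfil_0_to_fract[OF p])
qed

end

text \<open>Equivalently the places of degree at most n: t^(q^k) - t is the product of the places
  whose degree divides k. The form chosen matches the denominators of the logarithm up to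
  T^n.\<close>

definition ramified :: "nat \<Rightarrow> 'f poly set" where
  "ramified n = {p. place p \<and> (\<exists>k. 0 < k \<and> k \<le> n \<and> p dvd frob_diff k)}"

lemma finite_ramified: "finite (ramified n)"
proof (rule finite_subset)
  show "ramified n \<subseteq> {p. degree p \<le> CARD('f) ^ n}"
  proof
    fix p assume "p \<in> ramified n"
    then obtain k where k: "0 < k" "k \<le> n" "p dvd frob_diff k" by (auto simp: ramified_def)
    hence "degree p \<le> CARD('f) ^ k"
      using dvd_imp_degree_le[OF k(3)] frob_diff_nonzero degree_frob_diff by metis
    also have "\<dots> \<le> CARD('f) ^ n" using k card_field_ge_2[where 'f = 'f] by (intro power_increasing) auto
    finally show "p \<in> {p. degree p \<le> CARD('f) ^ n}" by simp
  qed
qed (rule finite_polys_degree_le)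

lemma ramified_place: "p \<in> ramified n \<Longrightarrow> place p"
  by (simp add: ramified_def)

lemma ramified_mono: "m \<le> n \<Longrightarrow> ramified m \<subseteq> ramified n"
  unfolding ramified_def by (blast intro: order.trans)

section \<open>Convergence of the Euler product\<close>

definition euler_prod :: "'f poly set \<Rightarrow> 'f poly fract fps" where
  "euler_prod S = (\<Prod>p\<in>S. inverse (euler_factor p))"

lemma euler_factor_nonramified:
  "place p \<Longrightarrow> p \<notin> ramified n \<Longrightarrow> 0 < i \<Longrightarrow> i \<le> n \<Longrightarrow> euler_factor p $ i = 0"
  by (rule euler_factor_trivial[of p n]) (auto simp: ramified_def)

lemma inverse_euler_factor_mult_nth:
  assumes "place p" "p \<notin> ramified n" "m \<le> n"
  shows "(inverse (euler_factor p) * G) $ m = G $ m"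
proof -
  have "euler_factor p * (inverse (euler_factor p) * G) = G"
    using inverse_mult_eq_1'[of "euler_factor p"] euler_factor_0[OF assms(1)] by (simp add: mult.assoc[symmetric])
  moreover have "(euler_factor p * (inverse (euler_factor p) * G)) $ m = (inverse (euler_factor p) * G) $ m"
    using assms euler_factor_nonramified by (intro fps_mult_nth_trivial[of _ n]) auto
  ultimately show ?thesis by metis
qed

text \<open>Factors at places outside \<open>ramified n\<close> are 1 modulo T^(n+1).\<close>

lemma euler_prod_stable:
  assumes "finite S" "ramified n \<subseteq> S" "\<And>p. p \<in> S \<Longrightarrow> place p" "m \<le> n"
  shows "euler_prod S $ m = euler_prod (ramified n) $ m"
proof -
  have "(euler_prod T * G) $ m = G $ m" if "finite T" "T \<subseteq> S - ramified n" for T G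
    using that
  proof (induction T arbitrary: G rule: finite_induct)
    case (insert p T)
    have "(euler_prod (insert p T) * G) $ m = (inverse (euler_factor p) * (euler_prod T * G)) $ m"
      using insert.hyps by (simp add: euler_prod_def mult.assoc)
    also have "\<dots> = (euler_prod T * G) $ m"
      using insert.prems assms by (intro inverse_euler_factor_mult_nth[of p n]) auto
    finally show ?case using insert by simp
  qed (simp add: euler_prod_def)
  from this[of "S - ramified n"] have
    "(euler_prod (S - ramified n) * euler_prod (ramified n)) $ m = euler_prod (ramified n) $ m"
    using assms by simp
  moreover have "euler_prod S = euler_prod (S - ramified n) * euler_prod (ramified n)"
    unfolding euler_prod_def using assms by (intro prod.subset_diff)
  ultimately show ?thesis by simp
qed

definition L_fps :: "'f poly fract fps" where
  "L_fps = Abs_fps (\<lambda>n. euler_prod (ramified n) $ n)"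

lemma L_fps_nth:
  assumes "finite S" "ramified n \<subseteq> S" "\<And>p. p \<in> S \<Longrightarrow> place p" "m \<le> n"
  shows "L_fps $ m = euler_prod S $ m"
proof -
  have "ramified m \<subseteq> S" using assms ramified_mono by blast
  from euler_prod_stable[of S m m, OF assms(1) this assms(3)] show ?thesis
    by (simp add: L_fps_def)
qed

lemma L_series_eq: "L_series \<phi> = L_fps"
proof -
  have "((\<lambda>S. \<Prod>p\<in>S. inverse (fps_of_poly (local_factor \<phi> p))) \<longlongrightarrow> L_fps)
      (finite_subsets_at_top {p. place p})"
  proof (rule tendsto_fpsI)
    fix n
    have "eventually (\<lambda>S. finite S \<and> ramified n \<subseteq> S \<and> S \<subseteq> {p. place p})
        (finite_subsets_at_top {p. place p})"
      unfolding eventually_finite_subsets_at_top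
      using finite_ramified[of n] ramified_place by (intro exI[of _ "ramified n"]) auto
    thus "eventually (\<lambda>S. (\<Prod>p\<in>S. inverse (fps_of_poly (local_factor \<phi> p))) $ n = L_fps $ n)
        (finite_subsets_at_top {p. place p})"
    proof eventually_elim
      case (elim S)
      hence "L_fps $ n = euler_prod S $ n" by (intro L_fps_nth) auto
      thus ?case by (simp add: euler_prod_def euler_factor_def)
    qed
  qed
  from tendsto_Lim[OF _ this] show ?thesis by (simp add: L_series_def)
qed

lemma L_series_at_eq: "L_series_at \<phi> p = euler_factor p * L_fps"
  by (simp add: L_series_at_def euler_factor_def L_series_eq)

section \<open>Integrality of the exponential of the L-series\<close>

definition exp_L :: "'f poly fract fps" where "exp_L = star exp_series L_fps"

lemma star_log_exp_L [simp]: "star log_series exp_L = L_fps"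
  by (simp add: exp_L_def)

context
  fixes p :: "'f poly"
  assumes p: "place p"
begin

interpretation filtration "vfil p" by (rule filtration_vfil[OF p])

lemma euler_factor_mult_L_W: "W (\<lambda>_. 0) (euler_factor p * L_fps)"
  unfolding W_def
proof
  fix n
  \<comment> \<open>The place p is added since it may lie outside \<open>ramified n\<close>, and its
    factor has to be present in order to cancel.\<close>
  let ?S = "insert p (ramified n)"
  have S: "finite ?S" "place q" if "q \<in> ?S" for q
    using that finite_ramified p ramified_place by auto
  have "(euler_factor p * L_fps) $ n = (euler_factor p * euler_prod ?S) $ n"
    unfolding fps_mult_nth using S p finite_ramified[of n]
    by (intro sum.cong refl arg_cong2[of _ _ _ _ "(*)"] L_fps_nth[of ?S n]) auto
  also have "euler_prod ?S = inverse (euler_factor p) * euler_prod (?S - {p})"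
    unfolding euler_prod_def using finite_ramified[of n] by (subst prod.remove[of _ p]) auto
  also have "euler_factor p * \<dots> = euler_prod (?S - {p})"
    using p by (simp add: inverse_mult_eq_1' flip: mult.assoc)
  finally have "(euler_factor p * L_fps) $ n = euler_prod (?S - {p}) $ n" .
  moreover have "W (\<lambda>_. 0) (euler_prod (?S - {p}))"
    unfolding euler_prod_def using euler_factor_W_other[OF p] ramified_place
    by (intro W_prod W_inverse) auto
  ultimately show "vfil p 0 ((euler_factor p * L_fps) $ n)" by (simp add: W_def)
qed

lemma exp_L_W: "W (\<lambda>_. 0) exp_L"
proof -
  \<comment> \<open>This is L / log(1), expanded by P_p so that numerator and denominator are
    integral at p; the denominator then has constant term 1.\<close>
  define c where "c = inverse (euler_factor p * log_series) * (euler_factor p * L_fps)"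
  have 0: "(euler_factor p * log_series) $ 0 = 1" using p by simp
  have "c * log_series = (euler_factor p * log_series * inverse (euler_factor p * log_series)) * L_fps" by (simp add: c_def algebra_simps)
  also have "\<dots> = L_fps" using 0 by (simp add: inverse_mult_eq_1')
  finally have "exp_L = act c 1" by (simp add: exp_L_def act_def)
  moreover have "W (\<lambda>_. 0) c"
    unfolding c_def using W_inverse[OF euler_factor_mult_log_W[OF p] _ 0]
    by (intro W_mult[OF _ euler_factor_mult_L_W]) auto
  ultimately show ?thesis using act_W[OF p] W_1[of "\<lambda>_. 0"] by simp
qed

end

text \<open>
  The valuation at infinity multiplied by the rank \<open>r\<close>: the \<open>n\<close>-th coefficient of the L-series has
  valuation at least \<open>n / r\<close>, which need not be an integer.
\<close>

definition vr :: "int \<Rightarrow> 'f poly fract \<Rightarrow> bool" where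
  "vr b x \<longleftrightarrow> (\<exists>m. vinf m x \<and> b \<le> int rk * m)"

lemma filtration_vr: "filtration vr"
proof
    fix m n and x y :: "'f poly fract"
    have "m \<le> int rk * \<bar>m\<bar>" using rk_pos mult_right_mono[of 1 "int rk" "\<bar>m\<bar>"] by simp
    thus "vr m 0" unfolding vr_def using vinf.V_0 by blast
    show "vr 0 1" unfolding vr_def using vinf.V_1 by (intro exI[of _ 0]) auto
    {
      assume "vr m x" "vr m y"
      then obtain a b where ab: "vinf a x" "m \<le> int rk * a" "vinf b y" "m \<le> int rk * b"
        unfolding vr_def by blast
      from ab(1,3) have "vinf (min a b) x" "vinf (min a b) y"
        by (auto elim!: vinf.V_mono)
      hence "vinf (min a b) (x + y) \<and> m \<le> int rk * min a b"
        using ab by (auto simp: min_def intro: vinf.V_add)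
      thus "vr m (x + y)" unfolding vr_def by blast
    }
    show "vr m (- x)" if "vr m x" using that vinf.V_minus unfolding vr_def by blast
    {
      assume "vr m x" "vr n y"
      then obtain a b where "vinf a x" "m \<le> int rk * a" "vinf b y" "n \<le> int rk * b"
        unfolding vr_def by blast
      hence "vinf (a + b) (x * y) \<and> m + n \<le> int rk * (a + b)"
        by (auto simp: distrib_left intro: vinf.V_mult)
      thus "vr (m + n) (x * y)" unfolding vr_def by blast
    }
    show "vr n x" if "vr m x" "n \<le> m" using that unfolding vr_def by (meson order.trans)
qed

interpretation vr: filtration vr by (rule filtration_vr)

lemma vinf_imp_vr: "vinf m x \<Longrightarrow> b \<le> int rk * m \<Longrightarrow> vr b x"
  unfolding vr_def by blast

lemma euler_factor_vr:
  assumes "place p"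
  shows "vr.W int (euler_factor p)"
  unfolding vr.W_def
proof
  fix n
  let ?c = "coeff (residue_size \<phi> p) n"
  show "vr (int n) (euler_factor p $ n)"
  proof (cases "?c = 0")
    case False
    have "vinf (int (degree p) + - int (degree ?c)) (euler_factor p $ n)"
      unfolding euler_factor_nth using place_nonzero[OF assms]
      by (intro vinf.V_mult vinf_inverse vinf_to_fract)
    moreover from False have "int (n + rk * degree ?c) \<le> int (rk * degree p)"
      using residue_size_coeff_bound[of p n] by (simp only: of_nat_le_iff simp_thms)
    hence "int n \<le> int rk * (int (degree p) + - int (degree ?c))"
      by (simp add: algebra_simps)
    ultimately show ?thesis by (rule vinf_imp_vr)
  qed (simp add: euler_factor_nth)
qed

lemma L_fps_vr: "vr.W int L_fps"
  unfolding vr.W_def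
proof
  fix n
  have "vr.W int (euler_prod (ramified n))"
    unfolding euler_prod_def using euler_factor_vr ramified_place
    by (intro vr.W_prod vr.W_inverse) auto
  thus "vr (int n) (L_fps $ n)" by (simp add: L_fps_def vr.W_def)
qed

text \<open>A bound for the pole orders of the coefficients of \<open>phi_t\<close> at infinity, in
  the scale of \<open>vr\<close>; the sum is a crude substitute for the maximum.\<close>

definition height :: nat where "height = rk * (\<Sum>i\<le>rk. degree (coeff phi_t i))"

lemma phi_t_vr: "vr (- int height) (emb phi_t $ i)"
proof (cases "i \<le> rk")
  case True
  have "degree (coeff phi_t i) \<le> (\<Sum>i\<le>rk. degree (coeff phi_t i))"
    using True by (intro member_le_sum) auto
  hence "rk * degree (coeff phi_t i) \<le> height" by (simp add: height_def)
  hence "int (rk * degree (coeff phi_t i)) \<le> int height" by (simp only: of_nat_le_iff)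
  thus ?thesis using vinf_to_fract[of "coeff phi_t i"] by (intro vinf_imp_vr) auto
next
  case False
  thus ?thesis by (simp add: coeff_eq_0 rk_def)
qed

text \<open>Induction with n = i + j: the inverse of t^(q^n) - t contributes r q^n, and only 1 \<le>
  j \<le> r matter because g_j = 0 beyond the rank. With h the height, the surplus over the claim is
  q^n (r - j) + (q^j - 2) h, which is nonnegative as q^j \<ge> 2.\<close>

lemma exp_coeff_vr:
  "vr (int (CARD('f) ^ n) * (int n - int height) + int height) (exp_coeff n)"
proof (induction n rule: less_induct)
  case (less n)
  let ?q = "\<lambda>i. int (CARD('f) ^ i)" and ?h = "int height"
  show ?case
  proof (cases "n = 0")
    case False
    have "vr (?q n * (int n - ?h) + ?h - int rk * ?q n)
        (\<Sum>i<n. emb phi_t $ (n - i) * exp_coeff i ^ (CARD('f) ^ (n - i)))"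
    proof (rule vr.V_sum)
      fix i assume i: "i \<in> {..<n}"
      define j where "j = n - i"
      have n: "n = i + j" "j > 0" using i by (auto simp: j_def)
      show "vr (?q n * (int n - ?h) + ?h - int rk * ?q n)
          (emb phi_t $ (n - i) * exp_coeff i ^ (CARD('f) ^ (n - i)))"
      proof (cases "j \<le> rk")
        case True
        have q2: "2 \<le> ?q j" using card_power_gt_1[OF n(2), where 'f = 'f] by linarith
        have "vr (- ?h + ?q j * (?q i * (int i - ?h) + ?h)) (emb phi_t $ j * exp_coeff i ^ (CARD('f) ^ j))"
          using less[of i] i phi_t_vr by (intro vr.V_mult vr.V_power) auto
        moreover have "?q n * (int n - ?h) + ?h - int rk * ?q n \<le> - ?h + ?q j * (?q i * (int i - ?h) + ?h)"
        proof -
          have "?q n = ?q j * ?q i" by (simp add: n power_add)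
          hence "- ?h + ?q j * (?q i * (int i - ?h) + ?h) -
              (?q n * (int n - ?h) + ?h - int rk * ?q n) =
              ?q n * (int rk - int j) + (?q j - 2) * ?h"
            by (simp add: n algebra_simps)
          moreover have "?q n * (int rk - int j) \<ge> 0" "(?q j - 2) * ?h \<ge> 0"
            using True q2 by (auto intro!: mult_nonneg_nonneg)
          ultimately show ?thesis by linarith
        qed
        ultimately show ?thesis unfolding j_def by (rule vr.V_mono)
      next
        case False
        thus ?thesis by (simp add: j_def coeff_eq_0 rk_def)
      qed
    qed
    moreover have "vr (int rk * ?q n) (inverse (to_fract (frob_diff n)))"
      using False vinf_inverse[OF frob_diff_nonzero[of n, where 'f = 'f]]
      by (intro vinf_imp_vr[of "?q n"]) (auto simp: degree_frob_diff)
    ultimately show ?thesis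
      using False by (subst exp_coeff.simps) (auto intro!: vr.V_mult')
  qed simp
qed

text \<open>With h the height, the terms of the n-th coefficient have scaled valuation at least q^i
  (n - h) + h at infinity, which is positive for n > h; an element of A with positive valuation
  there is 0.\<close>

lemma exp_L_emb: "\<exists>P. exp_L = emb P"
proof (rule emb_eqI[of _ "height + 1"])
  fix n
  show rng: "exp_L $ n \<in> range to_fract"
  proof (rule everywhere_integral)
    fix p :: "'f poly" assume p: "place p"
    interpret filtration "vfil p" by (rule filtration_vfil[OF p])
    show "vfil p 0 (exp_L $ n)" using exp_L_W[OF p] by (simp add: W_def)
  qed
  assume n: "n \<ge> height + 1"
  have "vr 1 (exp_L $ n)"
    unfolding exp_L_def star_nth
  proof (rule vr.V_sum)
    fix i assume i: "i \<in> {0..n}"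
    let ?q = "int (CARD('f) ^ i)"
    have "vr (?q * int (n - i)) ((L_fps $ (n - i)) ^ (CARD('f) ^ i))"
      using L_fps_vr by (intro vr.V_power) (auto simp: vr.W_def)
    from vr.V_mult[OF exp_coeff_vr[of i] this]
    have "vr (?q * (int n - int height) + int height) (exp_series $ i * (L_fps $ (n - i)) ^ (CARD('f) ^ i))"
      using i by (simp add: algebra_simps of_nat_diff)
    moreover have "1 \<le> ?q * (int n - int height) + int height"
      using n mult_mono[of 1 ?q 1 "int n - int height"] card_field_ge_2[where 'f = 'f] by auto
    ultimately show "vr 1 (exp_series $ i * (L_fps $ (n - i)) ^ (CARD('f) ^ i))" by (rule vr.V_mono)
  qed
  then obtain m where m: "vinf m (exp_L $ n)" "1 \<le> int rk * m" unfolding vr_def by blast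
  from m(2) have "m \<ge> 1" using rk_pos by (metis int_one_le_iff_zero_less of_nat_0_less_iff zero_less_mult_pos dual_order.strict_trans1)
  moreover from rng obtain a where a: "exp_L $ n = to_fract a" by blast
  ultimately have "vinf 1 (to_fract a)"
    using m(1) filtration.V_mono[OF filtration_vinf] by metis
  hence "a = 0" by (rule vinf_1_to_fract)
  thus "exp_L $ n = 0" by (simp add: a)
qed

end

section \<open>Vanishing at \<open>T = 1\<close> and torsion\<close>

text \<open>Membership in the Tate algebra for series over K, expressed by the filtration.\<close>

definition tends_zero :: "'f::{field,finite} poly \<Rightarrow> 'f poly fract fps \<Rightarrow> bool" where
  "tends_zero p F \<longleftrightarrow> (\<forall>N::nat. \<exists>n0. \<forall>n\<ge>n0. vfil p (int N) (F $ n))"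

lemma vfil_inverse_exists:
  fixes a :: "'f::{field,finite} poly"
  assumes p: "place p" and "a \<noteq> 0"
  shows "\<exists>k::nat. vfil p (- int k) (inverse (to_fract a))"
proof -
  interpret filtration "vfil p" by (rule filtration_vfil[OF p])
  obtain k b where b: "a = p ^ k * b" "\<not> p dvd b" using place_power_decomp[OF assms] by blast
  have "vfil p (int k * (- 1) + 0) (inverse (to_fract p) ^ k * inverse (to_fract b))"
    by (intro V_mult V_power vfil_inverse_place[OF p] vfil_inverse[OF b(2)])
  thus ?thesis by (intro exI[of _ k]) (simp add: b(1) power_inverse)
qed

lemma tends_zero_const_mult:
  assumes p: "place p" and x: "vfil p (- int k) x" and F: "tends_zero p F"
  shows "tends_zero p (fps_const x * F)"
  unfolding tends_zero_def
proof
  interpret filtration "vfil p" by (rule filtration_vfil[OF p])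
  fix N
  obtain n0 where "\<forall>n\<ge>n0. vfil p (int (N + k)) (F $ n)" using F unfolding tends_zero_def by blast
  hence "\<forall>n\<ge>n0. vfil p (int N) ((fps_const x * F) $ n)" using x by (auto intro: V_mult')
  thus "\<exists>n0. \<forall>n\<ge>n0. vfil p (int N) ((fps_const x * F) $ n)" by blast
qed

lemma tends_zero_X_minus_1_mult:
  assumes p: "place p" and F: "tends_zero p F"
  shows "tends_zero p ((fps_X - 1) * F)"
  unfolding tends_zero_def
proof
  interpret filtration "vfil p" by (rule filtration_vfil[OF p])
  fix N
  obtain n0 where n0: "\<forall>n\<ge>n0. vfil p (int N) (F $ n)" using F unfolding tends_zero_def by blast
  have "vfil p (int N) (((fps_X - 1) * F) $ n)" if "n \<ge> Suc n0" for n
  proof -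
    have "((fps_X - 1) * F) $ n = F $ (n - 1) - F $ n" using that by (simp add: left_diff_distrib)
    thus ?thesis using n0 that by (auto intro: V_diff)
  qed
  thus "\<exists>n0. \<forall>n\<ge>n0. vfil p (int N) (((fps_X - 1) * F) $ n)" by blast
qed

text \<open>The constant term of (T - 1)^m is a unit, so quotients by it exist in K[[T]] and only
  their convergence is in question.\<close>

lemma X_minus_1_power_cancel:
  "(fps_X - 1) ^ m * inverse ((fps_X - 1) ^ m) = (1 :: 'a::field fps)"
  by (rule inverse_mult_eq_1') (simp add: fps_nth_power_0)

lemma X_minus_1_inverse_Suc:
  "(fps_X - 1) * (F * inverse ((fps_X - 1) ^ Suc m)) = (F * inverse ((fps_X - 1) ^ m) :: 'a::field fps)"
proof -
  have "(fps_X - 1) * (F * inverse ((fps_X - 1) ^ Suc m)) =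
      ((fps_X - 1) ^ m * inverse ((fps_X - 1) ^ m)) * ((fps_X - 1) * (F * inverse ((fps_X - 1) ^ Suc m)))"
    by (simp only: X_minus_1_power_cancel mult_1)
  also have "\<dots> = F * inverse ((fps_X - 1) ^ m) * ((fps_X - 1) ^ Suc m * inverse ((fps_X - 1) ^ Suc m))"
    by (simp only: power_Suc mult_ac)
  also have "\<dots> = F * inverse ((fps_X - 1) ^ m)" by (simp only: X_minus_1_power_cancel mult_1_right)
  finally show ?thesis .
qed

lemma emb_X_minus_1: "emb [:- 1, 1:] = fps_X - 1"
proof -
  have "[:- 1, 1:] = pCons (- 1) 1" by (simp add: one_pCons)
  thus ?thesis by (simp only: emb_pCons emb_1) simp
qed

context drinfeld
begin

context
  fixes p :: "'f poly"
  assumes p: "place p"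
begin

interpretation filtration "vfil p" by (rule filtration_vfil[OF p])

text \<open>As P is a polynomial, the n-th coefficient receives only terms with i \<ge> n - deg P,
  and these have valuation at least q^i - i \<ge> i.\<close>

lemma tends_zero_star_log:
  assumes "W (\<lambda>_. 1) (emb P)"
  shows "tends_zero p (star log_series (emb P))"
  unfolding tends_zero_def
proof
  fix N
  have "vfil p (int N) (star log_series (emb P) $ n)" if n: "n \<ge> N + degree P" for n
    unfolding star_nth
  proof (rule V_sum)
    fix i assume i: "i \<in> {0..n}"
    show "vfil p (int N) (log_series $ i * (emb P $ (n - i)) ^ (CARD('f) ^ i))"
    proof (cases "n - i > degree P")
      case False
      have "vfil p (int (CARD('f) ^ i)) ((emb P $ (n - i)) ^ (CARD('f) ^ i))"
        using assms by (intro V_power'[of 1]) (auto simp: W_def)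
      moreover have "int (2 * i) \<le> int (CARD('f) ^ i)"
        by (simp only: of_nat_le_iff card_power_ge)
      hence "int N \<le> - int i + int (CARD('f) ^ i)" using False n i by simp
      ultimately show ?thesis
        using log_coeff_vfil[OF p, of i] by (intro V_mult'[of "- int i"]) auto
    qed (simp add: coeff_eq_0 zero_power)
  qed
  thus "\<exists>n0. \<forall>n\<ge>n0. vfil p (int N) (star log_series (emb P) $ n)" by blast
qed

text \<open>
  The \<open>p\<close>-adic logarithm is injective on \<open>p\<^sup>2A\<close>: in \<open>\<Sum> l\<^sub>i z\<^bsup>q^i\<^esup>\<close> the term \<open>z\<close> dominates all others.
  Multiplication by \<open>1 / (1 - T)\<close> produces the partial sums of this series at \<open>T = 1\<close>.
\<close>

lemma log_injective_at_1:
  assumes Y: "W (\<lambda>_. 2) (emb Y)" and G: "star log_series (emb Y) = (fps_X - 1) * G" "tends_zero p G"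
  shows "poly Y 1 = 0"
proof -
  define H :: "'f poly fract fps" where "H = Abs_fps (\<lambda>_. 1)"
  define s where "s n = (emb Y * H) $ n" for n
  let ?z = "to_fract (poly Y 1)"
  have H: "(fps_X - 1) * H = - 1"
  proof (rule fps_ext)
    fix n show "((fps_X - 1) * H) $ n = (- 1) $ n"
      by (cases n) (simp_all add: H_def left_diff_distrib)
  qed
  have "frob_fixed H" by (simp add: frob_fixed_def H_def)
  hence "star log_series (emb Y * H) = H * star log_series (emb Y)"
    using star_frob_fixed_mult[of H log_series "emb Y"] by (simp add: mult.commute)
  also have "\<dots> = ((fps_X - 1) * H) * G" by (simp add: G(1) mult_ac)
  finally have S: "star log_series (emb Y * H) = - G" by (simp add: H)
  have s_nth: "s n = (\<Sum>j=0..n. to_fract (coeff Y j))" for n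
    by (simp add: s_def fps_mult_nth H_def)
  have s2: "vfil p 2 (s n)" for n
    unfolding s_nth using Y by (intro V_sum) (simp add: W_def)
  have sz: "s n = ?z" if "n \<ge> degree Y" for n
  proof -
    have "s n = (\<Sum>j\<in>{..degree Y}. to_fract (coeff Y j))"
      unfolding s_nth using that by (intro sum.mono_neutral_right) (auto simp: coeff_eq_0)
    thus ?thesis by (simp add: poly_altdef)
  qed
  have z2: "vfil p 2 ?z" using s2[of "degree Y"] sz[of "degree Y"] by simp
  have step: "vfil p (int (Suc k)) ?z" if k: "k \<ge> 2" and zk: "vfil p (int k) ?z" for k
  proof -
    obtain n0 where n0: "\<forall>n\<ge>n0. vfil p (int (Suc k)) (G $ n)"
      using G(2) unfolding tends_zero_def by blast
    \<comment> \<open>Large enough for three purposes: \<open>G $ N\<close> is small,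
      \<open>s N\<close> has reached Y(1), and every i with N - i < deg Y is at least k + 1.\<close>
    define N where "N = n0 + degree Y + Suc k"
    have "- G $ N = (\<Sum>i=0..N. log_coeff i * s (N - i) ^ (CARD('f) ^ i))"
      using S[THEN arg_cong[where f = "\<lambda>F. F $ N"]] by (simp add: star_nth s_def)
    also have "\<dots> = s N + (\<Sum>i=1..N. log_coeff i * s (N - i) ^ (CARD('f) ^ i))"
      by (simp add: sum.atLeast_Suc_atMost)
    also have "s N = ?z" by (rule sz) (simp add: N_def)
    finally have "?z = - G $ N - (\<Sum>i=1..N. log_coeff i * s (N - i) ^ (CARD('f) ^ i))" by simp
    also have "vfil p (int (Suc k)) \<dots>"
    proof (intro V_diff V_sum)
      show "vfil p (int (Suc k)) (- G $ N)" using n0 by (simp add: V_minus N_def)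
      fix i assume i: "i \<in> {1..N}"
      have q: "int (2 * i) \<le> int (CARD('f) ^ i)"
        by (simp only: of_nat_le_iff card_power_ge)
      show "vfil p (int (Suc k)) (log_coeff i * s (N - i) ^ (CARD('f) ^ i))"
      proof (cases "N - i \<ge> degree Y")
        case True
        \<comment> \<open>The lower bound (i + 1) k - i = k + i (k - 1) exceeds k only for k \<ge>
          2; this is why Y is taken divisible by p^2.\<close>
        have ge: "int (i + 1) * int k \<le> int (CARD('f) ^ i) * int k"
          using q i by (intro mult_right_mono) auto
        moreover have "int i * 2 \<le> int i * int k" using k by (intro mult_left_mono) auto
        moreover have "int (i + 1) * int k = int i * int k + int k" by (simp add: algebra_simps)
        moreover have "int i \<ge> 1" using i by simp
        ultimately have "int (Suc k) \<le> - int i + int (i + 1) * int k" by linarith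
        with ge have "int (Suc k) \<le> - int i + int (CARD('f) ^ i) * int k" by linarith
        thus ?thesis using True sz V_power[OF zk, of "CARD('f) ^ i"] log_coeff_vfil[OF p, of i]
          by (intro V_mult'[of "- int i"]) auto
      next
        case False
        hence "i \<ge> Suc k" using i by (simp add: N_def)
        hence "int (Suc k) \<le> - int i + int (CARD('f) ^ i) * 2" using q by simp
        thus ?thesis using V_power[OF s2, of "CARD('f) ^ i"] log_coeff_vfil[OF p, of i]
          by (intro V_mult'[of "- int i"]) auto
      qed
    qed
    finally show ?thesis .
  qed
  have "vfil p (int (k + 2)) ?z" for k
  proof (induction k)
    case 0
    show ?case using z2 by simp
  next
    case (Suc k)
    thus ?case using step[of "k + 2"] by simp
  qed
  hence "vfil p (int k) ?z" for k by (rule V_mono[of "int (k + 2)"]) simp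
  hence "?z = 0" by (rule vfil_all_imp_0[OF p])
  thus ?thesis by simp
qed

text \<open>Applying |phi~(F_p)| moves P into pA[T], and log turns the action into multiplication;
  (T - 1)^m passes through both as a series over F.\<close>

lemma torsion_relation:
  assumes "act (emb [:a:]) exp_L = (fps_X - 1) ^ m * emb P"
  obtains Q where "act (emb (residue_size \<phi> p)) (emb P) = emb Q" "W (\<lambda>_. 1) (emb Q)"
    "fps_const (to_fract a * to_fract p) * (euler_factor p * L_fps) = (fps_X - 1) ^ m * star log_series (emb Q)"
proof -
  let ?c = "emb (residue_size \<phi> p)"
  obtain Q where Q: "act ?c (emb P) = emb Q" using act_emb_emb by blast
  have "frob_fixed ((fps_X - 1) ^ m :: 'f poly fract fps)" by (intro frob_fixed_power_fps) simp
  note ff = act_frob_fixed_mult_right[OF this] star_frob_fixed_mult[OF this]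
  have "act ?c (act (emb [:a:]) exp_L) = (fps_X - 1) ^ m * emb Q" by (simp add: assms ff Q)
  hence "star log_series (act ?c (act (emb [:a:]) exp_L)) = (fps_X - 1) ^ m * star log_series (emb Q)"
    by (simp add: ff)
  hence "?c * (emb [:a:] * L_fps) = (fps_X - 1) ^ m * star log_series (emb Q)" by (simp add: star_log_act)
  moreover have "?c * (emb [:a:] * L_fps) = fps_const (to_fract a) * (?c * L_fps)"
    by (simp add: emb_const mult_ac)
  moreover have "\<dots> = fps_const (to_fract a * to_fract p) * (euler_factor p * L_fps)"
    by (simp add: euler_factor_mult[OF p, symmetric] fps_const_mult[symmetric] mult.assoc del: fps_const_mult)
  ultimately show ?thesis using that[OF Q] act_residue_size[OF p, of P] Q by simp
qed

lemma torsion_imp_tends_zero: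
  assumes a: "a \<noteq> 0" and "act (emb [:a:]) exp_L = (fps_X - 1) ^ m * emb P"
  shows "tends_zero p (euler_factor p * L_fps * inverse ((fps_X - 1) ^ m))"
proof -
  obtain Q where Q: "W (\<lambda>_. 1) (emb Q)"
    "fps_const (to_fract a * to_fract p) * (euler_factor p * L_fps) = (fps_X - 1) ^ m * star log_series (emb Q)"
    using torsion_relation[OF assms(2)] by blast
  let ?x = "inverse (to_fract (a * p))"
  have ap: "a * p \<noteq> 0" using a place_nonzero[OF p] by simp
  have "fps_const ?x * fps_const (to_fract a * to_fract p) = 1" using ap by (simp add: field_simps)
  hence "euler_factor p * L_fps * inverse ((fps_X - 1) ^ m) =
      fps_const ?x * (fps_const (to_fract a * to_fract p) * (euler_factor p * L_fps)) * inverse ((fps_X - 1) ^ m)"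
    by (simp only: mult.assoc[symmetric] mult_1)
  also have "\<dots> = fps_const ?x * star log_series (emb Q) * ((fps_X - 1) ^ m * inverse ((fps_X - 1) ^ m))"
    unfolding Q(2) by (simp only: mult_ac)
  also have "\<dots> = fps_const ?x * star log_series (emb Q)" by (simp only: X_minus_1_power_cancel mult_1_right)
  finally have e: "euler_factor p * L_fps * inverse ((fps_X - 1) ^ m) = fps_const ?x * star log_series (emb Q)" .
  obtain k where "vfil p (- int k) ?x" using vfil_inverse_exists[OF p ap] by blast
  thus ?thesis unfolding e by (intro tends_zero_const_mult[OF p] tends_zero_star_log Q)
qed

text \<open>One factor T - 1 is gained at a time: the case m supplies P, and divisibility of L_p by
  one more factor makes P(1) a torsion point, killed by some nonzero b in A.\<close>

lemma tends_zero_imp_torsion: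
  assumes "tends_zero p (euler_factor p * L_fps * inverse ((fps_X - 1) ^ m))"
  shows "\<exists>a P. a \<noteq> 0 \<and> act (emb [:a:]) exp_L = (fps_X - 1) ^ m * emb P"
  using assms
proof (induction m)
  case 0
  obtain P where "exp_L = emb P" using exp_L_emb by blast
  hence "act (emb [:1:]) exp_L = (fps_X - 1) ^ 0 * emb P" by (simp flip: one_pCons)
  thus ?case by (intro exI[of _ 1] exI[of _ P]) simp
next
  case (Suc m)
  let ?F = "euler_factor p * L_fps * inverse ((fps_X - 1) ^ Suc m)" and ?c = "residue_size \<phi> p"
  have "tends_zero p ((fps_X - 1) * ?F)" using tends_zero_X_minus_1_mult[OF p Suc.prems] .
  hence "tends_zero p (euler_factor p * L_fps * inverse ((fps_X - 1) ^ m))"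
    by (simp only: X_minus_1_inverse_Suc)
  then obtain a P where a: "a \<noteq> 0" and P: "act (emb [:a:]) exp_L = (fps_X - 1) ^ m * emb P"
    using Suc.IH by blast
  obtain Q where Q: "act (emb ?c) (emb P) = emb Q" "W (\<lambda>_. 1) (emb Q)"
    "fps_const (to_fract a * to_fract p) * (euler_factor p * L_fps) = (fps_X - 1) ^ m * star log_series (emb Q)"
    using torsion_relation[OF P] by blast
  \<comment> \<open>One more factor p moves Q from pA[T] into p^2 A[T], as
    \<open>log_injective_at_1\<close> requires.\<close>
  obtain Y where Y: "act (emb [:p:]) (emb Q) = emb Y" using act_emb_emb by blast
  have "W (\<lambda>_. 2) (emb Y)"
    unfolding W_def
  proof
    fix n
    have "vfil p (2 * 1) (emb Y $ n - to_fract p * emb Q $ n)"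
      using act_approx[OF p, of 1 n "emb Q" p] Q(2) by (simp add: Y W_def)
    moreover have "vfil p (1 + 1) (to_fract p * emb Q $ n)"
      using Q(2) by (intro V_mult) (auto simp: vfil_1_to_fract[OF p] W_def)
    ultimately have "vfil p 2 ((emb Y $ n - to_fract p * emb Q $ n) + to_fract p * emb Q $ n)"
      by (intro V_add) auto
    thus "vfil p 2 (emb Y $ n)" by simp
  qed
  moreover have "star log_series (emb Y) = (fps_X - 1) * (fps_const (to_fract (p * a * p)) * ?F)"
  proof -
    have "(fps_X - 1) * (fps_const (to_fract (p * a * p)) * ?F) =
        fps_const (to_fract (p * a * p)) * ((fps_X - 1) * ?F)" by (simp only: mult_ac)
    also have "\<dots> = fps_const (to_fract p) * inverse ((fps_X - 1) ^ m) *
        (fps_const (to_fract a * to_fract p) * (euler_factor p * L_fps))"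
      unfolding X_minus_1_inverse_Suc
      by (simp only: to_fract_mult fps_const_mult[symmetric] mult_ac)
    also have "\<dots> = fps_const (to_fract p) * star log_series (emb Q) *
        ((fps_X - 1) ^ m * inverse ((fps_X - 1) ^ m))"
      unfolding Q(3) by (simp only: mult_ac)
    also have "\<dots> = star log_series (emb Y)"
      unfolding X_minus_1_power_cancel by (simp add: Y[symmetric] star_log_act emb_const)
    finally show ?thesis by simp
  qed
  moreover have "tends_zero p (fps_const (to_fract (p * a * p)) * ?F)"
    using vfil_0_to_fract[OF p, of "p * a * p"]
    by (intro tends_zero_const_mult[OF p, of 0] Suc.prems) (simp only: of_nat_0 minus_zero)
  ultimately have Y1: "poly Y 1 = 0" by (rule log_injective_at_1)
  \<comment> \<open>Y arises from P through p |phi~(F_p)| in A[T], but the criterion asks for a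
    multiplier in A; by \<open>poly_1_act\<close> its value at T = 1 has the same effect
    there.\<close>
  define b where "b = poly ([:p:] * ?c) 1"
  have b: "b \<noteq> 0"
    using residue_size_at_1_nonzero[of p] place_nonzero[OF p] by (simp add: b_def)
  obtain R where R: "act (emb [:b:]) (emb P) = emb R" using act_emb_emb by blast
  have "act (emb ([:p:] * ?c)) (emb P) = emb Y" unfolding emb_mult act_mult Q(1) Y ..
  from poly_1_act[OF this R[unfolded b_def]] Y1 have "poly R 1 = 0" by simp
  then obtain R' where R': "R = [:- 1, 1:] * R'" by (auto simp: poly_eq_0_iff_dvd elim: dvdE)
  have "frob_fixed ((fps_X - 1) ^ m :: 'f poly fract fps)" by (intro frob_fixed_power_fps) simp
  note ff = act_frob_fixed_mult_right[OF this]
  have "[:b * a:] = [:b:] * [:a:]" by simp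
  hence "act (emb [:b * a:]) exp_L = act (emb [:b:]) (act (emb [:a:]) exp_L)"
    by (simp only: emb_mult act_mult)
  also have "\<dots> = (fps_X - 1) ^ m * emb R" unfolding P ff R ..
  also have "\<dots> = (fps_X - 1) ^ Suc m * emb R'"
    unfolding R' emb_mult emb_X_minus_1 by (simp only: power_Suc mult_ac)
  finally show ?case using a b by (intro exI[of _ "b * a"] exI[of _ R']) simp
qed

lemma tends_zero_iff_torsion:
  "tends_zero p (L_series_at \<phi> p * inverse ((fps_X - 1) ^ m)) \<longleftrightarrow>
     (\<exists>a P. a \<noteq> 0 \<and> act (emb [:a:]) exp_L = (fps_X - 1) ^ m * emb P)"
  using torsion_imp_tends_zero tends_zero_imp_torsion unfolding L_series_at_eq by blast

end

end

section \<open>Divisibility in the Tate algebra\<close>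

lemma vfil_iff_le:
  fixes p :: "'f::{field,finite} poly"
  assumes p: "place p" and "\<not> p dvd a" "\<not> p dvd b" and x: "x = to_fract p powi n * Fract a b"
  shows "vfil p m x \<longleftrightarrow> m \<le> n"
proof -
  interpret filtration "vfil p" by (rule filtration_vfil[OF p])
  have pw: "vfil p k (to_fract p powi k)" for k
    unfolding vfil_def using place_not_unit[OF p]
    by (intro exI[of _ 1]) auto
  have b: "b \<noteq> 0" using assms(3) by auto
  have n: "vfil p n x" unfolding vfil_def using assms by (auto simp: Fract_conv_to_fract)
  show ?thesis
  proof
    assume m: "vfil p m x"
    show "m \<le> n"
    proof (rule ccontr)
      assume "\<not> m \<le> n"
      have "vfil p (m + - n + 0) (x * to_fract p powi (- n) * to_fract b)"
        by (intro V_mult m pw vfil_0_to_fract[OF p])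
      also have "x * to_fract p powi (- n) * to_fract b = to_fract a"
        using b place_nonzero[OF p] by (simp add: x Fract_conv_to_fract power_int_minus)
      finally have "vfil p 1 (to_fract a)" using \<open>\<not> m \<le> n\<close> by (elim V_mono) simp
      thus False using assms(2) vfil_1_to_fract[OF p] by blast
    qed
  qed (rule V_mono[OF n])
qed

text \<open>\<open>padic_val\<close> is a definite description; uniqueness of the exponent holds
  because \<open>vfil_iff_le\<close> recovers it as the largest m with
  \<open>vfil p m x\<close>.\<close>

lemma padic_val_spec:
  fixes p :: "'f::{field,finite} poly"
  assumes p: "place p" and "x \<noteq> 0"
  shows "\<exists>a b. x = to_fract p powi padic_val p x * Fract a b \<and> \<not> p dvd a \<and> \<not> p dvd b"
  unfolding padic_val_def
proof (rule theI')
  let ?P = "\<lambda>n. \<exists>a b. x = to_fract p powi n * Fract a b \<and> \<not> p dvd a \<and> \<not> p dvd b"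
  obtain a b where ab: "x = to_fract a / to_fract b" "b \<noteq> 0"
    by (cases x) (auto simp: Fract_conv_to_fract)
  with \<open>x \<noteq> 0\<close> have "a \<noteq> 0" by auto
  obtain i a' where a': "a = p ^ i * a'" "\<not> p dvd a'"
    using place_power_decomp[OF p \<open>a \<noteq> 0\<close>] by blast
  obtain j b' where b': "b = p ^ j * b'" "\<not> p dvd b'"
    using place_power_decomp[OF p \<open>b \<noteq> 0\<close>] by blast
  have "x = to_fract p powi (int i - int j) * Fract a' b'"
    using place_nonzero[OF p] by (simp add: ab a' b' Fract_conv_to_fract power_int_diff)
  hence ex: "?P (int i - int j)" using a' b' by blast
  show "\<exists>!n. ?P n"
  proof (rule ex1I[of ?P, OF ex])
    fix n assume "?P n"
    hence "m \<le> n \<longleftrightarrow> m \<le> int i - int j" for m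
      using vfil_iff_le[OF p] ex by metis
    thus "n = int i - int j" by (metis order.antisym order_refl)
  qed
qed

lemma vfil_iff_padic_val: "place p \<Longrightarrow> x \<noteq> 0 \<Longrightarrow> vfil p m x \<longleftrightarrow> m \<le> padic_val p x"
  using padic_val_spec[of p x] vfil_iff_le by blast

lemma padic_val_eqI:
  fixes p :: "'f::{field,finite} poly"
  assumes p: "place p" and "x \<noteq> 0" "x = to_fract p powi n * Fract a b" "\<not> p dvd a" "\<not> p dvd b"
  shows "padic_val p x = n"
proof -
  have "m \<le> padic_val p x \<longleftrightarrow> m \<le> n" for m
    using vfil_iff_le[OF p assms(4,5,3)] vfil_iff_padic_val[OF p assms(2)] by blast
  thus ?thesis by (metis order.antisym order_refl)
qed

locale padic =
  fixes p :: "'f::{field,finite} poly"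
  assumes p: "place p"
begin

sublocale filtration "vfil p" by (rule filtration_vfil[OF p])

definition abs_base :: real where "abs_base = real CARD('f) ^ degree p"

lemma abs_base_gt_1: "abs_base > 1"
  unfolding abs_base_def using card_field_ge_2[where 'f = 'f] place_degree[OF p]
  by (intro one_less_power) auto

lemma padic_abs_eq: "x \<noteq> 0 \<Longrightarrow> padic_abs p x = abs_base powi (- padic_val p x)"
  by (simp add: padic_abs_def abs_base_def)

lemma padic_abs_0 [simp]: "padic_abs p 0 = 0"
  by (simp add: padic_abs_def)

lemma padic_abs_nonneg [simp]: "padic_abs p x \<ge> 0"
  using abs_base_gt_1 by (cases "x = 0") (simp_all add: padic_abs_eq)

lemma padic_abs_le_iff: "padic_abs p x \<le> abs_base powi (- m) \<longleftrightarrow> vfil p m x"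
proof (cases "x = 0")
  case True
  thus ?thesis using abs_base_gt_1 by simp
next
  case False
  thus ?thesis using abs_base_gt_1
    by (simp add: padic_abs_eq vfil_iff_padic_val[OF p False])
       (metis linorder_not_le neg_le_iff_le power_int_increasing power_int_strict_increasing less_imp_le)
qed

lemma padic_abs_minus [simp]: "padic_abs p (- x) = padic_abs p x"
proof -
  have le: "padic_abs p (- y) \<le> padic_abs p y" for y
  proof (cases "y = 0")
    case False
    have "vfil p (padic_val p y) y" using vfil_iff_padic_val[OF p False] by simp
    from V_minus[OF this] show ?thesis by (simp add: padic_abs_le_iff padic_abs_eq[OF False])
  qed simp
  from le[of x] le[of "- x"] show ?thesis by simp
qed

lemma padic_abs_triangle: "padic_abs p (x + y) \<le> padic_abs p x + padic_abs p y"
proof (cases "x = 0 \<or> y = 0")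
  case False
  let ?m = "min (padic_val p x) (padic_val p y)"
  have "vfil p ?m (x + y)"
    using False by (intro V_add) (auto simp: vfil_iff_padic_val[OF p])
  hence "padic_abs p (x + y) \<le> abs_base powi (- ?m)" by (simp add: padic_abs_le_iff)
  also have "\<dots> \<le> padic_abs p x + padic_abs p y"
    using False padic_abs_nonneg[of x] padic_abs_nonneg[of y]
    by (auto simp: min_def padic_abs_eq simp del: padic_abs_nonneg)
  finally show ?thesis .
qed auto

lemma padic_abs_triangle_diff: "padic_abs p (x - y) \<le> padic_abs p x + padic_abs p y"
  using padic_abs_triangle[of x "- y"] by simp

lemma padic_abs_mult: "padic_abs p (x * y) = padic_abs p x * padic_abs p y"
proof (cases "x = 0 \<or> y = 0")
  case False
  hence nz: "x \<noteq> 0" "y \<noteq> 0" "x * y \<noteq> 0" by auto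
  let ?a = "padic_val p x" and ?b = "padic_val p y"
  obtain a b where ab: "x = to_fract p powi ?a * Fract a b" "\<not> p dvd a" "\<not> p dvd b"
    using padic_val_spec[OF p nz(1)] by blast
  obtain d e where de: "y = to_fract p powi ?b * Fract d e" "\<not> p dvd d" "\<not> p dvd e"
    using padic_val_spec[OF p nz(2)] by blast
  have "x * y = (to_fract p powi ?a * Fract a b) * (to_fract p powi ?b * Fract d e)"
    using ab(1) de(1) by simp
  also have "\<dots> = to_fract p powi (?a + ?b) * Fract (a * d) (b * e)"
    using place_nonzero[OF p] by (simp add: power_int_add)
  finally have xy: "x * y = to_fract p powi (?a + ?b) * Fract (a * d) (b * e)" .
  have "padic_val p (x * y) = ?a + ?b"
    by (rule padic_val_eqI[OF p nz(3) xy]) (use ab(2,3) de(2,3) place_dvd_mult[OF p] in blast)+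
  thus ?thesis using nz abs_base_gt_1 by (simp add: padic_abs_eq power_int_add power_int_diff power_int_minus field_simps)
qed auto

lemma padic_abs_tendsto_iff:
  "(\<lambda>n. padic_abs p (F $ n)) \<longlonglongrightarrow> 0 \<longleftrightarrow> tends_zero p F"
  unfolding tends_zero_def
proof
  assume lim: "(\<lambda>n. padic_abs p (F $ n)) \<longlonglongrightarrow> 0"
  show "\<forall>N::nat. \<exists>n0. \<forall>n\<ge>n0. vfil p (int N) (F $ n)"
  proof
    fix N :: nat
    have "abs_base powi (- int N) > 0" using abs_base_gt_1 by simp
    from order_tendstoD(2)[OF lim this] obtain n0 where
      "\<forall>n\<ge>n0. padic_abs p (F $ n) < abs_base powi (- int N)" unfolding eventually_sequentially by blast
    thus "\<exists>n0. \<forall>n\<ge>n0. vfil p (int N) (F $ n)" by (meson less_imp_le padic_abs_le_iff)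
  qed
next
  assume *: "\<forall>N::nat. \<exists>n0. \<forall>n\<ge>n0. vfil p (int N) (F $ n)"
  show "(\<lambda>n. padic_abs p (F $ n)) \<longlonglongrightarrow> 0"
  proof (rule LIMSEQ_I)
    fix e :: real assume "e > 0"
    obtain N where "(1 / abs_base) ^ N < e" using real_arch_pow_inv[of e "1 / abs_base"] abs_base_gt_1 \<open>e > 0\<close> by auto
    hence N: "abs_base powi (- int N) < e" by (simp add: power_int_minus power_one_over inverse_eq_divide)
    from * obtain n0 where "\<forall>n\<ge>n0. vfil p (int N) (F $ n)" by blast
    hence "\<forall>n\<ge>n0. padic_abs p (F $ n) < e"
      using padic_abs_le_iff N by (meson order.strict_trans1)
    thus "\<exists>no. \<forall>n\<ge>no. norm (padic_abs p (F $ n) - 0) < e" by auto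
  qed
qed

section \<open>Cauchy sequences, null sequences and their quotient\<close>

abbreviation C where "C \<equiv> padic_cauchy_ring p"
abbreviation I where "I \<equiv> padic_null_seqs p"
abbreviation R where "R \<equiv> K_completion p"

lemma carrier_C: "x \<in> carrier C \<longleftrightarrow> (\<forall>e>0. \<exists>N. \<forall>m\<ge>N. \<forall>n\<ge>N. padic_abs p (x m - x n) < e)"
  by (simp add: padic_cauchy_ring_def)

lemma C_simps [simp]:
  "x \<otimes>\<^bsub>C\<^esub> y = (\<lambda>n. x n * y n)" "\<one>\<^bsub>C\<^esub> = (\<lambda>_. 1)"
  "x \<oplus>\<^bsub>C\<^esub> y = (\<lambda>n. x n + y n)" "\<zero>\<^bsub>C\<^esub> = (\<lambda>_. 0)"
  by (simp_all add: padic_cauchy_ring_def)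

lemma C_const [simp]: "(\<lambda>_. x) \<in> carrier C"
  by (simp add: carrier_C)

lemma C_minus: "x \<in> carrier C \<Longrightarrow> (\<lambda>n. - x n) \<in> carrier C"
  using padic_abs_minus[of "x m - x n" for m n] unfolding carrier_C by (simp add: minus_diff_commute)

lemma C_add:
  assumes "x \<in> carrier C" "y \<in> carrier C"
  shows "(\<lambda>n. x n + y n) \<in> carrier C"
  unfolding carrier_C
proof (intro allI impI)
  fix e :: real assume "e > 0"
  then obtain N M where N: "\<And>m n. m \<ge> N \<Longrightarrow> n \<ge> N \<Longrightarrow> padic_abs p (x m - x n) < e / 2"
    and M: "\<And>m n. m \<ge> M \<Longrightarrow> n \<ge> M \<Longrightarrow> padic_abs p (y m - y n) < e / 2"
    using assms unfolding carrier_C by (meson half_gt_zero)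
  have "padic_abs p (x m + y m - (x n + y n)) < e" if "m \<ge> max N M" "n \<ge> max N M" for m n
    using padic_abs_triangle[of "x m - x n" "y m - y n"] N[of m n] M[of m n] that
    by (simp add: algebra_simps)
  thus "\<exists>N. \<forall>m\<ge>N. \<forall>n\<ge>N. padic_abs p (x m + y m - (x n + y n)) < e" by blast
qed

lemma C_bounded:
  assumes "x \<in> carrier C"
  shows "\<exists>B>0. \<forall>n. padic_abs p (x n) \<le> B"
proof -
  obtain N where N: "\<forall>m\<ge>N. \<forall>n\<ge>N. padic_abs p (x m - x n) < 1"
    using assms[unfolded carrier_C, rule_format, of 1] by auto
  let ?B = "1 + (\<Sum>i\<le>N. padic_abs p (x i))"
  have le: "padic_abs p (x n) \<le> (\<Sum>i\<le>N. padic_abs p (x i))" if "n \<le> N" for n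
    using that by (intro member_le_sum) auto
  have "padic_abs p (x n) \<le> ?B" for n
  proof (cases "n \<le> N")
    case False
    have "padic_abs p (x n) \<le> padic_abs p (x n - x N) + padic_abs p (x N)"
      using padic_abs_triangle[of "x n - x N" "x N"] by simp
    moreover have "padic_abs p (x n - x N) < 1" using N False by simp
    ultimately show ?thesis using le[of N] by simp
  qed (use le in fastforce)
  moreover have "?B > 0" by (simp add: add_pos_nonneg sum_nonneg)
  ultimately show ?thesis by blast
qed

lemma C_mult:
  assumes "x \<in> carrier C" "y \<in> carrier C"
  shows "(\<lambda>n. x n * y n) \<in> carrier C"
  unfolding carrier_C
proof (intro allI impI)
  fix e :: real assume e: "e > 0"
  obtain A where A: "A > 0" "\<And>n. padic_abs p (x n) \<le> A" using C_bounded[OF assms(1)] by blast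
  obtain B where B: "B > 0" "\<And>n. padic_abs p (y n) \<le> B" using C_bounded[OF assms(2)] by blast
  have "e / (2 * B) > 0" "e / (2 * A) > 0" using e A B by simp_all
  then obtain N M where N: "\<And>m n. m \<ge> N \<Longrightarrow> n \<ge> N \<Longrightarrow> padic_abs p (x m - x n) < e / (2 * B)"
    and M: "\<And>m n. m \<ge> M \<Longrightarrow> n \<ge> M \<Longrightarrow> padic_abs p (y m - y n) < e / (2 * A)"
    using assms unfolding carrier_C by meson
  have "padic_abs p (x m * y m - x n * y n) < e" if mn: "m \<ge> max N M" "n \<ge> max N M" for m n
  proof -
    have "x m * y m - x n * y n = x m * (y m - y n) + y n * (x m - x n)"
      by (simp add: algebra_simps)
    hence "padic_abs p (x m * y m - x n * y n) \<le>
        padic_abs p (x m) * padic_abs p (y m - y n) + padic_abs p (y n) * padic_abs p (x m - x n)"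
      by (metis padic_abs_triangle padic_abs_mult)
    also have "\<dots> \<le> A * padic_abs p (y m - y n) + B * padic_abs p (x m - x n)"
      using A B by (intro add_mono mult_right_mono) auto
    also have "\<dots> < A * (e / (2 * A)) + B * (e / (2 * B))"
      using A B N[of m n] M[of m n] mn by (intro add_strict_mono mult_strict_left_mono) auto
    also have "\<dots> = e" using A B by simp
    finally show ?thesis .
  qed
  thus "\<exists>N. \<forall>m\<ge>N. \<forall>n\<ge>N. padic_abs p (x m * y m - x n * y n) < e" by blast
qed

lemma cring_C: "cring C"
proof (rule cringI)
  show "abelian_group C"
  proof (rule abelian_groupI)
    fix x assume "x \<in> carrier C"
    thus "\<exists>y\<in>carrier C. y \<oplus>\<^bsub>C\<^esub> x = \<zero>\<^bsub>C\<^esub>"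
      using C_minus by (intro bexI[of _ "\<lambda>n. - x n"]) auto
  qed (auto simp: C_add algebra_simps)
  show "Group.comm_monoid C"
    by (rule comm_monoidI) (auto simp: C_mult algebra_simps)
qed (auto simp: algebra_simps)

interpretation C: cring C by (rule cring_C)

lemma mem_I: "x \<in> I \<longleftrightarrow> (\<lambda>n. padic_abs p (x n)) \<longlonglongrightarrow> 0"
  by (simp add: padic_null_seqs_def)

lemma I_subset: "I \<subseteq> carrier C"
proof
  fix x assume "x \<in> I"
  hence lim: "(\<lambda>n. padic_abs p (x n)) \<longlonglongrightarrow> 0" by (simp add: mem_I)
  show "x \<in> carrier C"
    unfolding carrier_C
  proof (intro allI impI)
    fix e :: real assume "e > 0"
    hence "e / 2 > 0" by simp
    from order_tendstoD(2)[OF lim this] obtain N where N: "\<And>n. n \<ge> N \<Longrightarrow> padic_abs p (x n) < e / 2"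
      unfolding eventually_sequentially by blast
    have "padic_abs p (x m - x n) < e" if "m \<ge> N" "n \<ge> N" for m n
      using padic_abs_triangle_diff[of "x m" "x n"] N[OF that(1)] N[OF that(2)] by simp
    thus "\<exists>N. \<forall>m\<ge>N. \<forall>n\<ge>N. padic_abs p (x m - x n) < e" by blast
  qed
qed

lemma I_add:
  assumes "x \<in> I" "y \<in> I"
  shows "(\<lambda>n. x n + y n) \<in> I"
proof -
  have "(\<lambda>n. padic_abs p (x n) + padic_abs p (y n)) \<longlonglongrightarrow> 0"
    using tendsto_add[of _ 0 _ _ 0] assms by (simp add: mem_I)
  thus ?thesis unfolding mem_I
    by (rule tendsto_0_le[where K = 1]) (auto intro!: always_eventually padic_abs_triangle)
qed

lemma I_mult:
  assumes "x \<in> I" "y \<in> carrier C"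
  shows "(\<lambda>n. x n * y n) \<in> I"
proof -
  obtain B where B: "B > 0" "\<And>n. padic_abs p (y n) \<le> B" using C_bounded[OF assms(2)] by blast
  have le: "padic_abs p (x n * y n) \<le> padic_abs p (x n) * B" for n
    using B by (simp add: padic_abs_mult mult_left_mono)
  have "(\<lambda>n. padic_abs p (x n)) \<longlonglongrightarrow> 0" using assms(1) by (simp add: mem_I)
  hence "(\<lambda>n. padic_abs p (x n * y n)) \<longlonglongrightarrow> 0"
    by (rule tendsto_0_le[where K = B]) (rule always_eventually, simp add: le)
  thus ?thesis by (simp add: mem_I)
qed

lemma ideal_I: "ideal I C"
proof (rule idealI)
  show "ring C" by (rule C.ring_axioms)
  show "subgroup I (add_monoid C)"
  proof (rule group.subgroupI)
    show "Group.group (add_monoid C)" by (rule C.a_group)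
    show "I \<subseteq> carrier (add_monoid C)" using I_subset by simp
    have "(\<lambda>_. 0) \<in> I" by (simp add: mem_I)
    thus "I \<noteq> {}" by blast
    fix x y assume x: "x \<in> I" and "y \<in> I"
    thus "x \<otimes>\<^bsub>add_monoid C\<^esub> y \<in> I" using I_add by simp
    have "\<ominus>\<^bsub>C\<^esub> x = (\<lambda>n. - x n)"
      using x I_subset C_minus by (intro C.minus_equality) auto
    thus "inv\<^bsub>add_monoid C\<^esub> x \<in> I" using x by (simp add: a_inv_def mem_I)
  qed
qed (use I_mult in \<open>auto simp: mult.commute\<close>)

interpretation I: ideal I C by (rule ideal_I)

lemma cring_R: "cring R"
  unfolding K_completion_def by (rule I.quotient_is_cring[OF cring_C])

interpretation R: cring R by (rule cring_R)

lemma coset_hom: "((+>\<^bsub>C\<^esub>) I) \<in> Ring.ring_hom C R"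
  unfolding K_completion_def by (rule I.rcos_ring_hom)

lemma K_embed_closed [simp]: "K_embed p x \<in> carrier R"
  unfolding K_embed_def using ring_hom_closed[OF coset_hom] by simp

lemma K_embed_add: "K_embed p (x + y) = K_embed p x \<oplus>\<^bsub>R\<^esub> K_embed p y"
  unfolding K_embed_def using ring_hom_add[OF coset_hom, of "\<lambda>_. x" "\<lambda>_. y"] by simp

lemma K_embed_mult: "K_embed p (x * y) = K_embed p x \<otimes>\<^bsub>R\<^esub> K_embed p y"
  unfolding K_embed_def using ring_hom_mult[OF coset_hom, of "\<lambda>_. x" "\<lambda>_. y"] by simp

lemma K_embed_1: "K_embed p 1 = \<one>\<^bsub>R\<^esub>"
  unfolding K_embed_def using ring_hom_one[OF coset_hom] by simp

lemma K_embed_0: "K_embed p 0 = \<zero>\<^bsub>R\<^esub>"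
  by (metis K_embed_add K_embed_closed R.add.l_cancel_one' add_0)

lemma K_embed_sum:
  "(\<Oplus>\<^bsub>R\<^esub>i\<in>A. K_embed p (f i)) = K_embed p (\<Sum>i\<in>A. f i)"
  by (induction A rule: infinite_finite_induct) (simp_all add: K_embed_0 K_embed_add)

text \<open>All representatives differ from the constant sequence by null sequences, so their
  absolute values have the same limit; the constant sequence itself makes that limit unique.\<close>

lemma K_completion_abs_embed: "K_completion_abs p (K_embed p x) = padic_abs p x"
proof -
  have mem: "y \<in> K_embed p x \<longleftrightarrow> (\<exists>h\<in>I. y = (\<lambda>n. h n + x))" for y
    by (auto simp: K_embed_def a_r_coset_def')
  have lim: "(\<lambda>n. padic_abs p (y n)) \<longlonglongrightarrow> padic_abs p x" if y: "y \<in> K_embed p x" for y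
  proof -
    obtain h where h: "h \<in> I" "y = (\<lambda>n. h n + x)" using y mem by blast
    have le: "\<bar>padic_abs p (y n) - padic_abs p x\<bar> \<le> padic_abs p (h n)" for n
      using padic_abs_triangle[of "h n" x] padic_abs_triangle_diff[of "h n + x" "h n"] h(2) by simp
    have "(\<lambda>n. padic_abs p (h n)) \<longlonglongrightarrow> 0" using h(1) by (simp add: mem_I)
    hence "(\<lambda>n. padic_abs p (y n) - padic_abs p x) \<longlonglongrightarrow> 0"
      by (rule tendsto_0_le[where K = 1]) (rule always_eventually, simp add: le)
    thus ?thesis by (simp add: LIM_zero_iff)
  qed
  have x: "(\<lambda>_. x) \<in> K_embed p x"
    unfolding mem by (rule bexI[of _ "\<lambda>_. 0"]) (simp_all add: mem_I)
  show ?thesis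
    unfolding K_completion_abs_def
  proof (rule the_equality)
    show "\<forall>y\<in>K_embed p x. (\<lambda>n. padic_abs p (y n)) \<longlonglongrightarrow> padic_abs p x" using lim by blast
    fix b assume b: "\<forall>y\<in>K_embed p x. (\<lambda>n. padic_abs p (y n)) \<longlonglongrightarrow> b"
    from bspec[OF b x] have "(\<lambda>n. padic_abs p x) \<longlonglongrightarrow> b" by simp
    thus "b = padic_abs p x" by (simp add: LIMSEQ_const_iff)
  qed
qed

section \<open>Cancellation in the Tate algebra\<close>

abbreviation T where "T \<equiv> tate_algebra p"
abbreviation emb_T where "emb_T \<equiv> tate_of_fps p"

lemma tate_mult: "f \<otimes>\<^bsub>T\<^esub> g = (\<lambda>n. \<Oplus>\<^bsub>R\<^esub>i\<in>{..n}. f i \<otimes>\<^bsub>R\<^esub> g (n - i))"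
  by (simp add: tate_algebra_def)

lemma emb_T_mult: "emb_T F \<otimes>\<^bsub>T\<^esub> emb_T G = emb_T (F * G)"
  unfolding tate_mult tate_of_fps_def fps_mult_nth atLeast0AtMost K_embed_sum[symmetric] K_embed_mult ..

lemma emb_T_1: "emb_T 1 = \<one>\<^bsub>T\<^esub>"
  by (rule ext) (simp add: tate_of_fps_def tate_algebra_def K_embed_1 K_embed_0)

lemma emb_T_power: "emb_T F [^]\<^bsub>T\<^esub> (m::nat) = emb_T (F ^ m)"
  by (induction m) (simp_all add: nat_pow_def emb_T_1 emb_T_mult mult.commute)

lemma emb_T_carrier: "emb_T F \<in> carrier T \<longleftrightarrow> (\<lambda>n. padic_abs p (F $ n)) \<longlonglongrightarrow> 0"
  by (simp add: tate_algebra_def tate_of_fps_def K_completion_abs_embed)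

text \<open>Coefficients are compared in turn; \<open>U $ 0\<close> is inverted already in K, so the
  commutative ring structure of K_p suffices.\<close>

lemma tate_mult_cancel:
  assumes u: "U $ 0 \<noteq> 0" and f: "\<And>n. f n \<in> carrier R" and g: "\<And>n. g n \<in> carrier R"
    and eq: "emb_T U \<otimes>\<^bsub>T\<^esub> f = emb_T U \<otimes>\<^bsub>T\<^esub> g"
  shows "f = g"
proof
  fix n
  show "f n = g n"
  proof (induction n rule: less_induct)
    case (less n)
    let ?u = "\<lambda>i. K_embed p (U $ i)"
    define r where "r h = (\<Oplus>\<^bsub>R\<^esub>i\<in>{1..n}. ?u i \<otimes>\<^bsub>R\<^esub> h (n - i))" for h
    have split: "(emb_T U \<otimes>\<^bsub>T\<^esub> h) n = ?u 0 \<otimes>\<^bsub>R\<^esub> h n \<oplus>\<^bsub>R\<^esub> r h"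
      if h: "\<And>n. h n \<in> carrier R" for h
    proof -
      have "{..n} = insert 0 {1..n}" by auto
      thus ?thesis unfolding tate_mult r_def using h
        by (simp add: tate_of_fps_def Pi_def)
    qed
    have "r f = r g"
      unfolding r_def using less f g by (intro R.finsum_cong') auto
    moreover have "r g \<in> carrier R" unfolding r_def using g by (intro R.finsum_closed) auto
    moreover have "?u 0 \<otimes>\<^bsub>R\<^esub> f n \<oplus>\<^bsub>R\<^esub> r f = ?u 0 \<otimes>\<^bsub>R\<^esub> g n \<oplus>\<^bsub>R\<^esub> r g"
      using split[of f, OF f] split[of g, OF g] by (simp only: eq)
    ultimately have "?u 0 \<otimes>\<^bsub>R\<^esub> f n = ?u 0 \<otimes>\<^bsub>R\<^esub> g n"
      using f[of n] g[of n] by simp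
    hence "K_embed p (inverse (U $ 0)) \<otimes>\<^bsub>R\<^esub> (?u 0 \<otimes>\<^bsub>R\<^esub> f n) =
        K_embed p (inverse (U $ 0)) \<otimes>\<^bsub>R\<^esub> (?u 0 \<otimes>\<^bsub>R\<^esub> g n)" by simp
    moreover have "K_embed p (inverse (U $ 0)) \<otimes>\<^bsub>R\<^esub> ?u 0 = \<one>\<^bsub>R\<^esub>"
      using u by (simp add: K_embed_1 flip: K_embed_mult)
    ultimately show "f n = g n" using f g by (simp flip: R.m_assoc)
  qed
qed

text \<open>By cancellation a quotient in the Tate algebra, a priori with coefficients in K_p, must
  be the image of F / U computed in K[[T]].\<close>

lemma divides_iff:
  assumes U: "U $ 0 \<noteq> 0"
  shows "emb_T U divides\<^bsub>T\<^esub> emb_T F \<longleftrightarrow> (\<lambda>n. padic_abs p ((F * inverse U) $ n)) \<longlonglongrightarrow> 0"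
proof -
  have "U * (F * inverse U) = F * (U * inverse U)" by (simp only: mult_ac)
  also have "\<dots> = F" using inverse_mult_eq_1'[OF U] by simp
  finally have *: "emb_T U \<otimes>\<^bsub>T\<^esub> emb_T (F * inverse U) = emb_T F" by (simp only: emb_T_mult)
  have "emb_T U divides\<^bsub>T\<^esub> emb_T F \<longleftrightarrow> emb_T (F * inverse U) \<in> carrier T"
  proof
    assume "emb_T U divides\<^bsub>T\<^esub> emb_T F"
    then obtain g where g: "g \<in> carrier T" "emb_T F = emb_T U \<otimes>\<^bsub>T\<^esub> g" by (auto simp: factor_def)
    have "g = emb_T (F * inverse U)"
    proof (rule tate_mult_cancel[OF U])
      show "g n \<in> carrier R" for n using g(1) by (simp add: tate_algebra_def)
      show "emb_T (F * inverse U) n \<in> carrier R" for n by (simp add: tate_of_fps_def)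
      show "emb_T U \<otimes>\<^bsub>T\<^esub> g = emb_T U \<otimes>\<^bsub>T\<^esub> emb_T (F * inverse U)" using * g(2) by simp
    qed
    thus "emb_T (F * inverse U) \<in> carrier T" using g(1) by simp
  qed (use * in \<open>auto simp: factor_def intro!: bexI[of _ "emb_T (F * inverse U)"]\<close>)
  thus ?thesis by (simp add: emb_T_carrier)
qed

lemma vanishing_order_at_one_eq:
  "vanishing_order_at_one p (emb_T F) =
     Sup {enat m | m. tends_zero p (F * inverse ((fps_X - 1) ^ m))}"
proof -
  have "((fps_X - 1) ^ m :: 'f poly fract fps) $ 0 \<noteq> 0" for m by (simp add: fps_nth_power_0)
  thus ?thesis
    unfolding vanishing_order_at_one_def emb_T_power by (simp add: divides_iff padic_abs_tendsto_iff)
qed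

end

theorem theorem2p17:
  fixes \<phi> :: "'f::{field,finite} poly \<Rightarrow> 'f poly poly"
    and p q :: "'f poly"
  assumes "drinfeld_model \<phi>" and "place p" and "place q"
  shows "vanishing_order_at_one p (tate_of_fps p (L_series_at \<phi> p)) =
         vanishing_order_at_one q (tate_of_fps q (L_series_at \<phi> q))"
proof -
  interpret drinfeld \<phi> by (rule drinfeld.intro[OF assms(1)])
  have "vanishing_order_at_one r (tate_of_fps r (L_series_at \<phi> r)) =
      Sup {enat m | m. \<exists>a P. a \<noteq> 0 \<and> act (emb [:a:]) exp_L = (fps_X - 1) ^ m * emb P}"
    if r: "place r" for r
    by (simp add: padic.vanishing_order_at_one_eq[OF padic.intro[OF r]] tends_zero_iff_torsion[OF r])
  thus ?thesis using assms(2,3) by simp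
qed

end
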